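(* Let $\lambda\ge1.678$ and let $\mathcal{A}$ be a $(\lambda,1+\frac{2}{e^\lambda})$-approximation LP-rounding algorithm for UFL. For FLM instances $(F,V,E,f,d)$ whose compatibility graph $G=(V,E)$ is perfectly matchable, consider the algorithm: (1) solve $(\mathrm{LP}_{\mathrm{FLM}})$ to obtain an optimal solution $(x^\star,y^\star)$; (2) set $x^\star_{i,j}:=\sum_{e\in\delta(j)}x^\star_{i,e}$ for $i\in F,j\in V$, and run $\mathcal{A}$ on the solution $(\{x^\star_{i,j}\}_{i\in F,j\in V},y^\star)$ of $(\mathrm{LP}_{\mathrm{UFL}})$ for the UFL instance $(F,V,f,d)$, obtaining a set $S\subseteq F$ of open facilities; (3) compute a perfect matching $M^\star_S$ of $G$ minimizing $\sum_{e\in M^\star_S}d(S,e)$; (4) set $\sigma_S(e):=\arg\min_{i\in S}d(i,e)$ for $e\in M^\star_S$; (5) return $(S,M^\star_S,\sigma_S)$. Then this algorithm is a $\max\{\lambda,2+\frac{2}{e^\lambda}\}$-approximation algorithm (expected cost at most that factor times the optimum). Moreover, for every $\lambda\ge1.678$, the integrality gap of $(\mathrm{LP}_{\mathrm{FLM}})$ is at most $\max\{\lambda,2+\frac{2}{e^\lambda}\}$ when the compatibility graph is perfectly matchable.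
   Context: An instance of Facility Location with Matching (FLM) is $(F,V,E,f,d)$: finite sets $F$ (facilities) and $V$ (clients), a metric $d$ on $F\cup V$, opening costs $f:F\to\mathbb{R}_{\ge0}$, and $E\subseteq\binom V2$; $G=(V,E)$ is the compatibility graph. For $i\in F$, $e=\{j,k\}\in E$: $d(i,e):=d(i,j)+d(i,k)$, $d(e):=d(j,k)$. For $S\subseteq F$: $d(S,j):=\min_{i\in S}d(i,j)$ for $j\in V$ and $d(S,e):=\min_{i\in S}d(i,e)$ for $e\in E$. A feasible solution is $(S,M,\sigma)$ with $S\subseteq F$, $M$ a maximum matching of $G$, $\sigma:M\to S$, of cost $\sum_{i\in S}f(i)+\sum_{e\in M}d(\sigma(e),e)$, to be minimized. $\delta(v)$: edges incident to $v$. $P_{\mathrm{MM}}(G)$: convex hull of characteristic vectors of maximum matchings of $G$. $(\mathrm{LP}_{\mathrm{FLM}})$: minimize $\sum_if(i)y_i+\sum_{i,e}d(i,e)x_{i,e}$ over $x\in\mathbb{R}^{F\times E}$, $y\in\mathbb{R}^F$ s.t. $(x_e)_e\in P_{\mathrm{MM}}(G)$ where $x_e:=\sum_ix_{i,e}$; $\sum_{e\in\delta(j)}x_{i,e}\le y_i$ for all $i\in F,j\in V$; $x,y\ge0$. The integrality gap is the supremum over considered instances of (optimal FLM cost)/(optimal LP value). UFL instance $(F,C,f,d)$, $d:F\times C\to\mathbb{R}_{\ge0}$ satisfying $d(i,j)\le d(i,j')+d(i',j')+d(i',j)$; solutions $(S,\sigma:C\to S)$ of cost $\sum_{i\in S}f(i)+\sum_jd(\sigma(j),j)$.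 $(\mathrm{LP}_{\mathrm{UFL}})$: minimize $\sum_if(i)y_i+\sum_{i,j}d(i,j)x_{i,j}$ s.t. $\sum_ix_{i,j}=1$ $\forall j$, $x_{i,j}\le y_i$, $x,y\ge0$. A $(\lambda_f,\lambda_c)$-approximation LP-rounding algorithm for UFL maps any feasible $(x,y)$ of $(\mathrm{LP}_{\mathrm{UFL}})$ to an integral solution of expected cost at most $\lambda_f\sum_if(i)y_i+\lambda_c\sum_{i,j}d(i,j)x_{i,j}$ (by Byrka–Aardal these exist for $(\lambda,1+2/e^\lambda)$ whenever $\lambda\ge1.678$). *)

theory Defs
  imports "HOL-Probability.Probability"
begin

section \<open>Matchings\<close>

text \<open>Edges are two-element vertex sets.\<close>

definition matching :: "'v set set \<Rightarrow> 'v set set \<Rightarrow> bool" where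
  "matching E M \<longleftrightarrow> M \<subseteq> E \<and> (\<forall>e\<in>M. \<forall>e'\<in>M. e \<noteq> e' \<longrightarrow> e \<inter> e' = {})"

definition maximum_matching :: "'v set set \<Rightarrow> 'v set set \<Rightarrow> bool" where
  "maximum_matching E M \<longleftrightarrow> matching E M \<and> (\<forall>M'. matching E M' \<longrightarrow> card M' \<le> card M)"

definition perfect_matching :: "'v set \<Rightarrow> 'v set set \<Rightarrow> 'v set set \<Rightarrow> bool" where
  "perfect_matching V E M \<longleftrightarrow> matching E M \<and> \<Union>M = V"

definition incident :: "'v set set \<Rightarrow> 'v \<Rightarrow> 'v set set" where
  "incident E v = {e \<in> E. v \<in> e}"

text \<open>The convex hull in \<open>\<real>\<^sup>E\<close> of the characteristic vectors of the (finitely many) maximum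
  matchings. A vector in \<open>\<real>\<^sup>E\<close> is a function whose values outside \<open>E\<close> are irrelevant.\<close>

definition P_MM :: "'v set set \<Rightarrow> ('v set \<Rightarrow> real) set" where
  "P_MM E = {z. \<exists>\<mu>. (\<forall>M\<in>{M. maximum_matching E M}. 0 \<le> \<mu> M)
                  \<and> (\<Sum>M\<in>{M. maximum_matching E M}. \<mu> M) = 1
                  \<and> (\<forall>e\<in>E. z e = (\<Sum>M\<in>{M. maximum_matching E M}. \<mu> M * indicator M e))}"

section \<open>Uncapacitated facility location\<close>

record ('f, 'c) ufl =
  ufl_F :: "'f set"
  ufl_C :: "'c set"
  ufl_f :: "'f \<Rightarrow> real"
  ufl_d :: "'f \<Rightarrow> 'c \<Rightarrow> real"

definition ufl_instance :: "('f, 'c) ufl \<Rightarrow> bool" where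
  "ufl_instance U \<longleftrightarrow> finite (ufl_F U) \<and> finite (ufl_C U)
     \<and> (\<forall>i\<in>ufl_F U. 0 \<le> ufl_f U i)
     \<and> (\<forall>i\<in>ufl_F U. \<forall>j\<in>ufl_C U. 0 \<le> ufl_d U i j)
     \<and> (\<forall>i\<in>ufl_F U. \<forall>i'\<in>ufl_F U. \<forall>j\<in>ufl_C U. \<forall>j'\<in>ufl_C U.
          ufl_d U i j \<le> ufl_d U i j' + ufl_d U i' j' + ufl_d U i' j)"

definition ufl_solution :: "('f, 'c) ufl \<Rightarrow> 'f set \<times> ('c \<Rightarrow> 'f) \<Rightarrow> bool" where
  "ufl_solution U = (\<lambda>(S, \<sigma>). S \<subseteq> ufl_F U \<and> \<sigma> \<in> ufl_C U \<rightarrow> S)"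

definition ufl_cost :: "('f, 'c) ufl \<Rightarrow> 'f set \<times> ('c \<Rightarrow> 'f) \<Rightarrow> real" where
  "ufl_cost U = (\<lambda>(S, \<sigma>). (\<Sum>i\<in>S. ufl_f U i) + (\<Sum>j\<in>ufl_C U. ufl_d U (\<sigma> j) j))"

definition ufl_lp_feasible :: "('f, 'c) ufl \<Rightarrow> ('f \<Rightarrow> 'c \<Rightarrow> real) \<Rightarrow> ('f \<Rightarrow> real) \<Rightarrow> bool" where
  "ufl_lp_feasible U x y \<longleftrightarrow>
     (\<forall>j\<in>ufl_C U. (\<Sum>i\<in>ufl_F U. x i j) = 1)
     \<and> (\<forall>i\<in>ufl_F U. \<forall>j\<in>ufl_C U. x i j \<le> y i)
     \<and> (\<forall>i\<in>ufl_F U. \<forall>j\<in>ufl_C U. 0 \<le> x i j)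
     \<and> (\<forall>i\<in>ufl_F U. 0 \<le> y i)"

text \<open>A randomized rounding algorithm returns a probability distribution on integral solutions.\<close>

type_synonym ('f, 'c) ufl_rounding =
  "('f, 'c) ufl \<Rightarrow> ('f \<Rightarrow> 'c \<Rightarrow> real) \<Rightarrow> ('f \<Rightarrow> real) \<Rightarrow> ('f set \<times> ('c \<Rightarrow> 'f)) pmf"

definition ufl_lp_rounding_approx :: "real \<Rightarrow> real \<Rightarrow> ('f, 'c) ufl_rounding \<Rightarrow> bool" where
  "ufl_lp_rounding_approx lam_f lam_c A \<longleftrightarrow>
     (\<forall>U x y. ufl_instance U \<longrightarrow> ufl_lp_feasible U x y \<longrightarrow>
        (\<forall>s\<in>set_pmf (A U x y). ufl_solution U s)
        \<and> measure_pmf.expectation (A U x y) (ufl_cost U)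
            \<le> lam_f * (\<Sum>i\<in>ufl_F U. ufl_f U i * y i)
              + lam_c * (\<Sum>i\<in>ufl_F U. \<Sum>j\<in>ufl_C U. ufl_d U i j * x i j))"

section \<open>Facility location with matching\<close>

text \<open>Facilities and clients are points of one type carrying the metric; they may overlap.\<close>

record 'a flm =
  flm_F :: "'a set"
  flm_V :: "'a set"
  flm_E :: "'a set set"
  flm_f :: "'a \<Rightarrow> real"
  flm_d :: "'a \<Rightarrow> 'a \<Rightarrow> real"

definition flm_instance :: "'a flm \<Rightarrow> bool" where
  "flm_instance I \<longleftrightarrow> finite (flm_F I) \<and> finite (flm_V I)
     \<and> Metric_space (flm_F I \<union> flm_V I) (flm_d I)
     \<and> (\<forall>i\<in>flm_F I. 0 \<le> flm_f I i)
     \<and> flm_E I \<subseteq> {e. e \<subseteq> flm_V I \<and> card e = 2}"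

definition perfectly_matchable :: "'a flm \<Rightarrow> bool" where
  "perfectly_matchable I \<longleftrightarrow> (\<exists>M. perfect_matching (flm_V I) (flm_E I) M)"

definition pm_instances :: "'a flm set" where
  "pm_instances = {I. flm_instance I \<and> perfectly_matchable I}"

text \<open>\<open>d(i,e) = d(i,j) + d(i,k)\<close> for \<open>e = {j,k}\<close>.\<close>

definition dist_edge :: "'a flm \<Rightarrow> 'a \<Rightarrow> 'a set \<Rightarrow> real" where
  "dist_edge I i e = (\<Sum>v\<in>e. flm_d I i v)"

definition dist_set_edge :: "'a flm \<Rightarrow> 'a set \<Rightarrow> 'a set \<Rightarrow> real" where
  "dist_set_edge I S e = (MIN i\<in>S. dist_edge I i e)"

type_synonym 'a flm_sol = "'a set \<times> 'a set set \<times> ('a set \<Rightarrow> 'a)"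

definition flm_solution :: "'a flm \<Rightarrow> 'a flm_sol \<Rightarrow> bool" where
  "flm_solution I = (\<lambda>(S, M, \<sigma>). S \<subseteq> flm_F I \<and> maximum_matching (flm_E I) M \<and> \<sigma> \<in> M \<rightarrow> S)"

definition flm_cost :: "'a flm \<Rightarrow> 'a flm_sol \<Rightarrow> real" where
  "flm_cost I = (\<lambda>(S, M, \<sigma>). (\<Sum>i\<in>S. flm_f I i) + (\<Sum>e\<in>M. dist_edge I (\<sigma> e) e))"

text \<open>Optimal values are extended reals, equal to \<open>\<infinity>\<close> for infeasible problems.\<close>

definition flm_opt :: "'a flm \<Rightarrow> ereal" where
  "flm_opt I = (INF s\<in>{s. flm_solution I s}. ereal (flm_cost I s))"

type_synonym 'a flm_lp_point = "('a \<Rightarrow> 'a set \<Rightarrow> real) \<times> ('a \<Rightarrow> real)"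

definition flm_lp_feasible :: "'a flm \<Rightarrow> 'a flm_lp_point \<Rightarrow> bool" where
  "flm_lp_feasible I = (\<lambda>(x, y).
     (\<lambda>e. \<Sum>i\<in>flm_F I. x i e) \<in> P_MM (flm_E I)
     \<and> (\<forall>i\<in>flm_F I. \<forall>j\<in>flm_V I. (\<Sum>e\<in>incident (flm_E I) j. x i e) \<le> y i)
     \<and> (\<forall>i\<in>flm_F I. \<forall>e\<in>flm_E I. 0 \<le> x i e)
     \<and> (\<forall>i\<in>flm_F I. 0 \<le> y i))"

definition flm_lp_cost :: "'a flm \<Rightarrow> 'a flm_lp_point \<Rightarrow> real" where
  "flm_lp_cost I = (\<lambda>(x, y). (\<Sum>i\<in>flm_F I. flm_f I i * y i)
     + (\<Sum>i\<in>flm_F I. \<Sum>e\<in>flm_E I. dist_edge I i e * x i e))"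

definition flm_lp_opt :: "'a flm \<Rightarrow> ereal" where
  "flm_lp_opt I = (INF p\<in>{p. flm_lp_feasible I p}. ereal (flm_lp_cost I p))"

text \<open>In type \<open>ereal\<close>, \<open>a / 0 = \<infinity>\<close> for \<open>a > 0\<close>, while \<open>0 / 0 = 0\<close> and \<open>\<infinity> / \<infinity> = 0\<close>: an instance
  with zero LP value and positive optimum makes the gap infinite, whereas instances on which both
  values vanish, or both problems are infeasible, do not contribute.\<close>

definition flm_integrality_gap :: "'a flm set \<Rightarrow> ereal" where
  "flm_integrality_gap \<I> = (SUP I\<in>\<I>. flm_opt I / flm_lp_opt I)"

section \<open>The algorithm\<close>

text \<open>The subroutines are arbitrary functions subject to the specifications below, so that every
  way of breaking ties is covered.\<close>

definition flm_lp_solver :: "('a flm \<Rightarrow> 'a flm_lp_point) \<Rightarrow> bool" where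
  "flm_lp_solver lp \<longleftrightarrow>
     (\<forall>I\<in>pm_instances. (\<exists>p. flm_lp_feasible I p) \<longrightarrow>
        is_arg_min (flm_lp_cost I) (flm_lp_feasible I) (lp I))"

definition min_perfect_matching_solver :: "('a flm \<Rightarrow> 'a set \<Rightarrow> 'a set set) \<Rightarrow> bool" where
  "min_perfect_matching_solver pm \<longleftrightarrow>
     (\<forall>I\<in>pm_instances. (\<forall>S. S \<subseteq> flm_F I \<longrightarrow>
        is_arg_min (\<lambda>M. \<Sum>e\<in>M. dist_set_edge I S e)
          (perfect_matching (flm_V I) (flm_E I)) (pm I S)))"

text \<open>The restriction to \<open>S \<noteq> {}\<close> loses nothing: \<open>S = {}\<close> arises only if there are no clients, and
  then there is no edge to assign.\<close>

definition nearest_facility_assignment ::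
    "('a flm \<Rightarrow> 'a set \<Rightarrow> 'a set set) \<Rightarrow> ('a flm \<Rightarrow> 'a set \<Rightarrow> 'a set \<Rightarrow> 'a) \<Rightarrow> bool" where
  "nearest_facility_assignment pm asg \<longleftrightarrow>
     (\<forall>I\<in>pm_instances.
        (\<forall>S e. S \<subseteq> flm_F I \<and> S \<noteq> {} \<and> e \<in> pm I S \<longrightarrow>
           is_arg_min (\<lambda>i. dist_edge I i e) (\<lambda>i. i \<in> S) (asg I S e)))"

definition flm_to_ufl :: "'a flm \<Rightarrow> ('a, 'a) ufl" where
  "flm_to_ufl I = \<lparr>ufl_F = flm_F I, ufl_C = flm_V I, ufl_f = flm_f I, ufl_d = flm_d I\<rparr>"

definition flm_algorithm ::
    "('a, 'a) ufl_rounding \<Rightarrow> ('a flm \<Rightarrow> 'a flm_lp_point) \<Rightarrow> ('a flm \<Rightarrow> 'a set \<Rightarrow> 'a set set)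
      \<Rightarrow> ('a flm \<Rightarrow> 'a set \<Rightarrow> 'a set \<Rightarrow> 'a) \<Rightarrow> 'a flm \<Rightarrow> 'a flm_sol pmf" where
  "flm_algorithm A lp pm asg I =
     (let (x, y) = lp I;
          x' = (\<lambda>i j. \<Sum>e\<in>incident (flm_E I) j. x i e)
      in map_pmf (\<lambda>(S, _). (S, pm I S, asg I S)) (A (flm_to_ufl I) x' y))"

text \<open>A guarantee on the class \<open>\<I>\<close> of instances; it concerns those that have a solution at all.\<close>

definition flm_approximation :: "'a flm set \<Rightarrow> real \<Rightarrow> ('a flm \<Rightarrow> 'a flm_sol pmf) \<Rightarrow> bool" where
  "flm_approximation \<I> \<rho> B \<longleftrightarrow>
     (\<forall>I\<in>\<I>. (\<exists>s. flm_solution I s) \<longrightarrow>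
        (\<forall>s\<in>set_pmf (B I). flm_solution I s)
        \<and> ereal (measure_pmf.expectation (B I) (flm_cost I)) \<le> ereal \<rho> * flm_opt I)"

end

theory Submission
  imports Defs
begin

text \<open>
  For an edge \<open>e = {j, k}\<close> and a set \<open>S\<close> of open facilities, \<open>d(S,e) \<le> d(S,j) + d(S,k) + d(j,k)\<close>, and
  \<open>d(j,k) \<le> d(i,e)\<close> for every facility \<open>i\<close>. A vector of the perfect matching polytope is a convex
  combination of perfect matchings, so some perfect matching has total edge length at most the LP
  connection cost \<open>C\<close>. Assigning each of its edges to the nearest open facility thus costs at most
  \<open>C\<close> more than the connection cost of the UFL solution.

  The integrality gap needs an actual rounding algorithm, but only for the \<open>\<gamma>\<close> with
  \<open>\<gamma> = 2 + 2 / e\<^sup>\<gamma>\<close>, which minimises \<open>max \<lambda> (2 + 2 / e\<^sup>\<lambda>)\<close>. At this \<open>\<gamma> \<le> e\<close> a simplified form of the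
  algorithm of Byrka and Aardal suffices. Scale \<open>y\<close> by \<open>\<gamma>\<close>; call the nearest unit of facility mass of
  a client \<open>j\<close> close and let \<open>R j\<close> be its radius. Greedily choose cluster centres in order of \<open>R\<close>, with
  disjoint close sets; open one facility of each cluster and all other pieces independently. Then
  \<open>j\<close> always finds an open facility within \<open>3 * R j\<close>, and a set of pieces of weight \<open>W\<close> stays closed
  with probability at most \<open>e\<^sup>-\<^sup>W\<close>. The choices are
  derandomised by the method of conditional expectations.
\<close>

section \<open>Rounding for uncapacitated facility location\<close>

text \<open>It serves both as the weight of a facility piece starting at \<open>t\<close> and as the
  length of a distance layer at \<open>t\<close>. Its value is meaningful only if \<open>T\<close>
  has an element above \<open>t\<close>, since otherwise \<open>Min\<close> is taken over the empty
  set.\<close>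

definition step :: "real set \<Rightarrow> real \<Rightarrow> real" where
  "step T t = Min {u \<in> T. t < u} - t"

lemma step_nonneg:
  assumes "finite T" "b \<in> T" "t < b"
  shows "0 \<le> step T t"
proof -
  have "Min {u \<in> T. t < u} \<in> {u \<in> T. t < u}"
    by (rule Min_in) (use assms in auto)
  then show ?thesis by (simp add: step_def)
qed

text \<open>The gaps telescope. With breakpoints as summation indices, this finite identity replaces
  integration over layers.\<close>

lemma sum_step:
  assumes "finite T" "a \<in> T" "b \<in> T" "a \<le> b"
  shows "(\<Sum>t | t \<in> T \<and> a \<le> t \<and> t < b. step T t) = b - a"
  using assms(3,4)
proof (induction "card {t \<in> T. t < b}" arbitrary: b rule: less_induct)
  case less
  show ?case
  proof (cases "a = b")
    case True
    then have "{t. t \<in> T \<and> a \<le> t \<and> t < b} = {}" by auto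
    then show ?thesis unfolding True by (metis (no_types, lifting) diff_self sum.empty)
  next
    case False
    with less.prems have ab: "a < b" by simp
    \<comment> \<open>The predecessor of \<open>b\<close> in \<open>T\<close>: its gap ends exactly
      at \<open>b\<close>, and the induction hypothesis covers the gaps before it.\<close>
    define s where "s = Max {t \<in> T. t < b}"
    have "s \<in> {t \<in> T. t < b}"
      unfolding s_def by (rule Max_in) (use assms(1,2) ab in auto)
    then have s: "s \<in> T" "s < b" by auto
    have s_max: "t \<le> s" if "t \<in> T" "t < b" for t
      using that assms(1) by (simp add: s_def)
    have as: "a \<le> s" using s_max assms(2) ab by blast
    have "Min {u \<in> T. s < u} = b"
      by (rule Min_eqI) (use assms(1) less.prems s s_max in \<open>force+\<close>)
    then have step_s: "step T s = b - s" by (simp add: step_def)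
    have "{t \<in> T. t < s} \<subset> {t \<in> T. t < b}" using s by auto
    then have "card {t \<in> T. t < s} < card {t \<in> T. t < b}"
      using assms(1) by (intro psubset_card_mono) auto
    from less.hyps[OF this s(1) as]
    have IH: "(\<Sum>t | t \<in> T \<and> a \<le> t \<and> t < s. step T t) = s - a" .
    have "{t. t \<in> T \<and> a \<le> t \<and> t < b} = insert s {t. t \<in> T \<and> a \<le> t \<and> t < s}"
      using s as s_max by force
    then have "(\<Sum>t | t \<in> T \<and> a \<le> t \<and> t < b. step T t)
        = step T s + (\<Sum>t | t \<in> T \<and> a \<le> t \<and> t < s. step T t)"
      using assms(1) by simp
    then show ?thesis using IH step_s by simp
  qed
qed

section \<open>Derandomised rounding of blocks\<close>

text \<open>This is the averaging step of the derandomisation; it also selects a short matching from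
  a convex combination.\<close>

lemma exists_le_weighted_average:
  fixes w g :: "'p \<Rightarrow> real"
  assumes "finite K" "\<And>c. c \<in> K \<Longrightarrow> 0 \<le> w c" "sum w K = 1"
  shows "\<exists>c\<in>K. g c \<le> (\<Sum>c\<in>K. w c * g c)"
proof (rule ccontr)
  define m where "m = (\<Sum>c\<in>K. w c * g c)"
  assume "\<not> ?thesis"
  then have gt: "m < g c" if "c \<in> K" for c using that by (force simp: m_def)
  have "(\<Sum>c\<in>K. w c * (g c - m)) = 0"
    using assms(3) by (simp add: right_diff_distrib sum_subtractf m_def flip: sum_distrib_right)
  moreover have "0 \<le> w c * (g c - m)" if "c \<in> K" for c
    using gt[OF that] assms(2)[OF that] by simp
  ultimately have "\<forall>c\<in>K. w c * (g c - m) = 0"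
    using assms(1) by (simp add: sum_nonneg_eq_0_iff)
  then have "\<forall>c\<in>K. w c = 0" using gt by force
  then show False using assms(3) by simp
qed

text \<open>One conditional-expectation step, where \<open>b l\<close> is a penalty paid if no
  opened piece lies in \<open>B l\<close>. In a block of weight one, a single piece is drawn with
  probabilities \<open>w\<close>. A lone piece of another weight is opened with probability
  \<open>1 - exp (- w p)\<close>, which is at most \<open>w p\<close> and makes the chance of
  staying closed exactly \<open>exp (- w p)\<close>, even if \<open>w p\<close> exceeds 1.\<close>

lemma round_block:
  fixes w f :: "'p \<Rightarrow> real" and b :: "'l \<Rightarrow> real"
  assumes fin: "finite K" "finite L"
    and w: "\<And>p. p \<in> K \<Longrightarrow> 0 \<le> w p" and f: "\<And>p. p \<in> K \<Longrightarrow> 0 \<le> f p"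
    and b: "\<And>l. l \<in> L \<Longrightarrow> 0 \<le> b l"
    and K: "sum w K = 1 \<or> (\<exists>p. K = {p})"
  shows "\<exists>N\<subseteq>K. (sum w K = 1 \<longrightarrow> N \<noteq> {}) \<and>
    sum f N + (\<Sum>l\<in>L. if N \<inter> B l = {} then b l else 0)
      \<le> (\<Sum>p\<in>K. w p * f p) + (\<Sum>l\<in>L. b l * exp (- sum w (B l \<inter> K)))"
proof (cases "sum w K = 1")
  case True
  define g where "g c = f c + (\<Sum>l\<in>L. if c \<notin> B l then b l else 0)" for c
  obtain c where c: "c \<in> K" "g c \<le> (\<Sum>c\<in>K. w c * g c)"
    using exists_le_weighted_average[of K w g] fin w True by blast
  have "(\<Sum>c\<in>K. w c * g c)
      = (\<Sum>p\<in>K. w p * f p) + (\<Sum>c\<in>K. \<Sum>l\<in>L. if c \<notin> B l then w c * b l else 0)"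
    by (simp add: g_def distrib_left sum.distrib sum_distrib_left if_distrib cong: if_cong)
  also have "(\<Sum>c\<in>K. \<Sum>l\<in>L. if c \<notin> B l then w c * b l else 0)
      = (\<Sum>l\<in>L. \<Sum>c\<in>K. if c \<notin> B l then w c * b l else 0)"
    by (rule sum.swap)
  also have "\<dots> \<le> (\<Sum>l\<in>L. b l * exp (- sum w (B l \<inter> K)))"
  proof (rule sum_mono)
    fix l assume l: "l \<in> L"
    have "(\<Sum>c\<in>K. if c \<notin> B l then w c * b l else 0) = (\<Sum>c\<in>K - B l. w c * b l)"
      using fin by (simp add: sum.If_cases Diff_eq Compl_eq)
    also have "\<dots> = b l * sum w (K - B l)" by (simp add: sum_distrib_left mult.commute)
    also have "sum w (K - B l) = 1 - sum w (B l \<inter> K)"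
      using sum.Int_Diff[OF fin(1), of w "B l"] True by (simp add: Int_commute)
    \<comment> \<open>The probability of missing \<open>B l\<close> is \<open>1 - W\<close> with
      \<open>W\<close> the weight of \<open>B l\<close> in \<open>K\<close>, and 1 - W \<le> exp
      (-W).\<close>
    also have "b l * \<dots> \<le> b l * exp (- sum w (B l \<inter> K))"
      using b[OF l] exp_ge_add_one_self[of "- sum w (B l \<inter> K)"] by (intro mult_left_mono) auto
    finally show "(\<Sum>c\<in>K. if c \<notin> B l then w c * b l else 0) \<le> b l * exp (- sum w (B l \<inter> K))" .
  qed
  finally have "g c \<le> (\<Sum>p\<in>K. w p * f p) + (\<Sum>l\<in>L. b l * exp (- sum w (B l \<inter> K)))"
    using c(2) by simp
  then show ?thesis using c(1) by (intro exI[of _ "{c}"]) (simp add: g_def)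
next
  case False
  with K obtain p where p: "K = {p}" by blast
  \<comment> \<open>\<open>X\<close> is the cost with \<open>p\<close> open and \<open>Y\<close> the
    cost with \<open>p\<close> closed. Their average is at most \<open>R\<close>, hence so is one of
    them.\<close>
  define R where "R = w p * f p + (\<Sum>l\<in>L. b l * exp (- sum w (B l \<inter> {p})))"
  define X where "X = f p + (\<Sum>l\<in>L. if {p} \<inter> B l = {} then b l else 0)"
  define Y where "Y = (\<Sum>l\<in>L. b l)"
  have "(1 - exp (- w p)) * X + exp (- w p) * Y
      = (1 - exp (- w p)) * f p + (\<Sum>l\<in>L. (1 - exp (- w p)) * (if {p} \<inter> B l = {} then b l else 0)
          + exp (- w p) * b l)"
    by (simp add: X_def Y_def distrib_left sum_distrib_left sum.distrib)
  also have "(\<Sum>l\<in>L. (1 - exp (- w p)) * (if {p} \<inter> B l = {} then b l else 0) + exp (- w p) * b l)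
      = (\<Sum>l\<in>L. b l * exp (- sum w (B l \<inter> {p})))"
    by (rule sum.cong) (auto simp: algebra_simps)
  also have "(1 - exp (- w p)) * f p \<le> w p * f p"
    using exp_ge_add_one_self[of "- w p"] f p by (intro mult_right_mono) auto
  finally have avg: "(1 - exp (- w p)) * X + exp (- w p) * Y \<le> R"
    by (simp add: R_def)
  have "X \<le> R \<or> Y \<le> R"
  proof (rule ccontr)
    assume "\<not> ?thesis"
    then have "R < X" "R < Y" by auto
    moreover have "exp (- w p) \<le> 1" using w p by simp
    ultimately have "(1 - exp (- w p)) * R \<le> (1 - exp (- w p)) * X" "exp (- w p) * R < exp (- w p) * Y"
      by (simp_all add: mult_left_mono)
    moreover have "(1 - exp (- w p)) * R + exp (- w p) * R = R" by (simp add: algebra_simps)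
    ultimately show False using avg by linarith
  qed
  then show ?thesis
  proof
    assume "X \<le> R"
    then show ?thesis using p by (intro exI[of _ "{p}"]) (simp add: X_def R_def)
  next
    assume "Y \<le> R"
    then show ?thesis using p False by (intro exI[of _ "{}"]) (simp add: Y_def R_def)
  qed
qed

text \<open>Blocks are fixed one after another. The right-hand side is a pessimistic estimator:
  independence across blocks turns the bounds on the missing probabilities into the exponential of
  the total weight.\<close>

lemma round_blocks:
  fixes w f :: "'p \<Rightarrow> real" and a :: "'l \<Rightarrow> real"
  assumes "finite \<K>" "finite L"
    and "\<And>K. K \<in> \<K> \<Longrightarrow> finite K" "disjoint \<K>"
    and "\<And>p. p \<in> \<Union>\<K> \<Longrightarrow> 0 \<le> w p" "\<And>p. p \<in> \<Union>\<K> \<Longrightarrow> 0 \<le> f p"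
    and "\<And>l. l \<in> L \<Longrightarrow> 0 \<le> a l"
    and "\<And>K. K \<in> \<K> \<Longrightarrow> sum w K = 1 \<or> (\<exists>p. K = {p})"
  shows "\<exists>N\<subseteq>\<Union>\<K>. (\<forall>K\<in>\<K>. sum w K = 1 \<longrightarrow> N \<inter> K \<noteq> {}) \<and>
    sum f N + (\<Sum>l\<in>L. if N \<inter> B l = {} then a l else 0)
      \<le> (\<Sum>p\<in>\<Union>\<K>. w p * f p) + (\<Sum>l\<in>L. a l * exp (- sum w (B l \<inter> \<Union>\<K>)))"
  using assms(1,3-)
proof (induction \<K> arbitrary: a rule: finite_induct)
  case empty
  then show ?case by simp
next
  case (insert K \<K>)
  define U where "U = \<Union>\<K>"
  have finU: "finite U" using insert.hyps(1) insert.prems(1) by (simp add: U_def)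
  have finK: "finite K" using insert.prems(1) by simp
  have KU: "K \<inter> U = {}"
    using insert.prems(2) insert.hyps(2) by (auto simp: U_def pairwise_insert disjnt_def)
  \<comment> \<open>The penalties are discounted in advance by the bound for the blocks still
    undecided.\<close>
  define b where "b l = a l * exp (- sum w (B l \<inter> U))" for l
  have "\<exists>N\<subseteq>K. (sum w K = 1 \<longrightarrow> N \<noteq> {}) \<and>
    sum f N + (\<Sum>l\<in>L. if N \<inter> B l = {} then b l else 0)
      \<le> (\<Sum>p\<in>K. w p * f p) + (\<Sum>l\<in>L. b l * exp (- sum w (B l \<inter> K)))"
    by (rule round_block) (use finK assms(2) insert.prems(3-) in \<open>simp_all add: b_def\<close>)
  then obtain N where N: "N \<subseteq> K" "sum w K = 1 \<longrightarrow> N \<noteq> {}"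
    "sum f N + (\<Sum>l\<in>L. if N \<inter> B l = {} then b l else 0)
      \<le> (\<Sum>p\<in>K. w p * f p) + (\<Sum>l\<in>L. b l * exp (- sum w (B l \<inter> K)))" by blast
  \<comment> \<open>Once \<open>N\<close> is fixed, the penalties it avoids drop out for the
    remaining blocks.\<close>
  define a' where "a' l = (if N \<inter> B l = {} then a l else 0)" for l
  have "\<exists>N'\<subseteq>\<Union>\<K>. (\<forall>K\<in>\<K>. sum w K = 1 \<longrightarrow> N' \<inter> K \<noteq> {}) \<and>
    sum f N' + (\<Sum>l\<in>L. if N' \<inter> B l = {} then a' l else 0)
      \<le> (\<Sum>p\<in>\<Union>\<K>. w p * f p) + (\<Sum>l\<in>L. a' l * exp (- sum w (B l \<inter> \<Union>\<K>)))"
  proof (rule insert.IH)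
    show "disjoint \<K>" using insert.prems(2) by (simp add: pairwise_insert)
    show "0 \<le> a' l" if "l \<in> L" for l using insert.prems(5)[OF that] by (simp add: a'_def)
  qed (simp_all add: insert.prems(1,3,4,6))
  then obtain N' where N': "N' \<subseteq> U" "\<forall>K\<in>\<K>. sum w K = 1 \<longrightarrow> N' \<inter> K \<noteq> {}"
    "sum f N' + (\<Sum>l\<in>L. if N' \<inter> B l = {} then a' l else 0)
      \<le> (\<Sum>p\<in>U. w p * f p) + (\<Sum>l\<in>L. a' l * exp (- sum w (B l \<inter> U)))"
    unfolding U_def[symmetric] by blast
  have c1: "sum f (N \<union> N') = sum f N + sum f N'"
    by (rule sum.union_disjoint)
      (use N(1) N'(1) KU finite_subset[OF _ finU] finite_subset[OF _ finK] in blast)+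
  have c2: "(\<Sum>l\<in>L. if (N \<union> N') \<inter> B l = {} then a l else 0)
      = (\<Sum>l\<in>L. if N' \<inter> B l = {} then a' l else 0)"
    by (rule sum.cong) (auto simp: a'_def)
  \<comment> \<open>What the remaining blocks start from is exactly what the block \<open>K\<close>
    left behind, so the two estimates chain.\<close>
  have c3: "(\<Sum>l\<in>L. a' l * exp (- sum w (B l \<inter> U)))
      = (\<Sum>l\<in>L. if N \<inter> B l = {} then b l else 0)"
    by (rule sum.cong) (auto simp: a'_def b_def)
  have c4: "(\<Sum>l\<in>L. b l * exp (- sum w (B l \<inter> K)))
      = (\<Sum>l\<in>L. a l * exp (- sum w (B l \<inter> (K \<union> U))))"
  proof (rule sum.cong)
    fix l
    have "sum w (B l \<inter> (K \<union> U)) = sum w (B l \<inter> K) + sum w (B l \<inter> U)"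
      unfolding Int_Un_distrib
      by (rule sum.union_disjoint) (use KU finU finK in auto)
    then show "b l * exp (- sum w (B l \<inter> K)) = a l * exp (- sum w (B l \<inter> (K \<union> U)))"
      by (simp add: b_def flip: exp_add)
  qed simp
  have c5: "(\<Sum>p\<in>K \<union> U. w p * f p) = (\<Sum>p\<in>K. w p * f p) + (\<Sum>p\<in>U. w p * f p)"
    by (rule sum.union_disjoint) (use KU finU finK in auto)
  have un: "\<Union>(insert K \<K>) = K \<union> U" by (simp add: U_def)
  have "sum f (N \<union> N') + (\<Sum>l\<in>L. if (N \<union> N') \<inter> B l = {} then a l else 0)
      \<le> (\<Sum>p\<in>\<Union>(insert K \<K>). w p * f p) + (\<Sum>l\<in>L. a l * exp (- sum w (B l \<inter> \<Union>(insert K \<K>))))"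
    unfolding un c1 c2 c5 c4[symmetric] using N(3) N'(3)[unfolded c3] by linarith
  moreover have "\<forall>K'\<in>insert K \<K>. sum w K' = 1 \<longrightarrow> (N \<union> N') \<inter> K' \<noteq> {}"
  proof
    fix K' assume "K' \<in> insert K \<K>"
    then show "sum w K' = 1 \<longrightarrow> (N \<union> N') \<inter> K' \<noteq> {}"
      using N(1,2) N'(2) by (cases "K' = K") (auto simp: Int_Un_distrib2)
  qed
  moreover have "N \<union> N' \<subseteq> \<Union>(insert K \<K>)" unfolding un using N(1) N'(1) by blast
  ultimately show ?case by (intro exI[of _ "N \<union> N'"] conjI)
qed

section \<open>Close mass and cluster centres\<close>

text \<open>Mass is collected in order of increasing \<open>d\<close> until it reaches
  \<open>t\<close>; the last facility used may be taken only in part, and its distance is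
  \<open>R\<close>.\<close>

lemma close_facilities:
  fixes a d :: "'f \<Rightarrow> real"
  assumes "finite F" "\<And>i. i \<in> F \<Longrightarrow> 0 \<le> a i" "0 < t" "t \<le> sum a F"
  shows "\<exists>R\<in>d ` F. \<exists>c. (\<forall>i\<in>F. 0 \<le> c i \<and> c i \<le> a i) \<and> sum c F = t
    \<and> (\<forall>i\<in>F. 0 < c i \<longrightarrow> d i \<le> R) \<and> (\<forall>i\<in>F. c i < a i \<longrightarrow> R \<le> d i)"
  using assms(1,2,4)
proof (induction F rule: finite_ranking_induct[where f = d])
  case empty
  then show ?case using assms(3) by simp
next
  case (insert i F)
  show ?case
  \<comment> \<open>The ranking induction inserts an element of largest \<open>d\<close> but does
    not exclude \<open>i \<in> F\<close>, so that case joins the one where the earlier facilities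
    already suffice.\<close>
  proof (cases "i \<in> F \<or> t \<le> sum a F")
    case True
    with insert.prems(2) have "t \<le> sum a F" by (auto simp: insert_absorb)
    from insert.IH[OF insert.prems(1) this] obtain R c where Rc: "R \<in> d ` F" "\<forall>i\<in>F. 0 \<le> c i \<and> c i \<le> a i" "sum c F = t"
      "\<forall>i\<in>F. 0 < c i \<longrightarrow> d i \<le> R" "\<forall>i\<in>F. c i < a i \<longrightarrow> R \<le> d i"
      by auto
    show ?thesis
    proof (cases "i \<in> F")
      case True
      then show ?thesis using Rc by (auto simp: insert_absorb)
    next
      case False
      have "(\<Sum>k\<in>F. (c(i := 0)) k) = t"
        using False Rc(3) by (subst sum.cong[of F F _ c]) auto
      then show ?thesis using Rc insert False
        by (intro bexI[of _ R] exI[of _ "c(i := 0)"]) auto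
    qed
  next
    case False
    define c where "c = a(i := t - sum a F)"
    have "sum c F = sum a F" using False by (intro sum.cong) (auto simp: c_def)
    then show ?thesis using False insert
      by (intro bexI[of _ "d i"] exI[of _ c]) (auto simp: c_def)
  qed
qed

text \<open>In order of increasing \<open>R\<close>, a client becomes a centre unless its set meets
  that of an earlier centre. A new centre is its own witness because its set is nonempty.\<close>

lemma greedy_clustering:
  fixes R :: "'c \<Rightarrow> real"
  assumes "finite V" "\<And>j. j \<in> V \<Longrightarrow> N j \<noteq> {}"
  shows "\<exists>D\<subseteq>V. disjoint_family_on N D \<and> (\<forall>j\<in>V. \<exists>k\<in>D. R k \<le> R j \<and> N j \<inter> N k \<noteq> {})"
  using assms
proof (induction V rule: finite_ranking_induct[where f = R])
  case empty
  then show ?case by (simp add: disjoint_family_on_def)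
next
  case (insert j V)
  then obtain D where D: "D \<subseteq> V" "disjoint_family_on N D"
    "\<forall>j\<in>V. \<exists>k\<in>D. R k \<le> R j \<and> N j \<inter> N k \<noteq> {}" by auto
  show ?case
  proof (cases "\<exists>k\<in>D. N j \<inter> N k \<noteq> {}")
    case True
    then show ?thesis using D insert by (intro exI[of _ D]) auto
  next
    case False
    then have "disjoint_family_on N (insert j D)"
      using D(2) by (auto simp: disjoint_family_on_def)
    then show ?thesis using D insert by (intro exI[of _ "insert j D"]) auto
  qed
qed

section \<open>Connection cost of a single client\<close>

text \<open>By convexity the graph of exp (-W) lies below its chord over [a, b]. Multiplying by
  \<open>b - a\<close> keeps the statement free of division.\<close>

lemma exp_uminus_le_chord:
  fixes a b W :: real
  assumes "a \<le> W" "W \<le> b"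
  shows "(b - a) * exp (- W) \<le> (b - W) * exp (- a) + (W - a) * exp (- b)"
proof (cases "a = b")
  case True
  then show ?thesis using assms by simp
next
  case False
  define u where "u = (W - a) / (b - a)"
  have u: "0 \<le> u" "u \<le> 1" "u * (b - a) = W - a" using assms False by (auto simp: u_def field_simps)
  have "exp ((1 - u) *\<^sub>R (- a) + u *\<^sub>R (- b)) \<le> (1 - u) * exp (- a) + u * exp (- b)"
    using convex_onD[OF exp_convex, of u "- a" "- b"] u by simp
  also have "(1 - u) *\<^sub>R (- a) + u *\<^sub>R (- b) = - W"
    using u(3) by (simp add: algebra_simps)
  finally have "(b - a) * exp (- W) \<le> (b - a) * ((1 - u) * exp (- a) + u * exp (- b))"
    using assms by (intro mult_left_mono) auto
  also have "\<dots> = (b - a - u * (b - a)) * exp (- a) + u * (b - a) * exp (- b)"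
    by (simp add: algebra_simps)
  finally show ?thesis unfolding u(3) by simp
qed


text \<open>Exchanging the sums lets each facility collect the layers below its own distance, so a
  bound linear in the mass beyond \<open>t\<close> becomes linear in the distances.\<close>

lemma sum_layers:
  fixes s d :: "_ \<Rightarrow> real"
  assumes "finite X"
  shows "(\<Sum>t\<in>X. s t * (\<alpha> + \<beta> * (\<Sum>i\<in>F. if t < d i then c i else 0)))
    = \<alpha> * sum s X + \<beta> * (\<Sum>i\<in>F. c i * sum s {t \<in> X. t < d i})"
proof -
  have "(\<Sum>t\<in>X. s t * (\<Sum>i\<in>F. if t < d i then c i else 0))
      = (\<Sum>t\<in>X. \<Sum>i\<in>F. if t < d i then c i * s t else 0)"
    unfolding sum_distrib_left by (intro sum.cong) auto
  also have "\<dots> = (\<Sum>i\<in>F. \<Sum>t\<in>X. if t < d i then c i * s t else 0)"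
    by (rule sum.swap)
  also have "\<dots> = (\<Sum>i\<in>F. c i * sum s {t \<in> X. t < d i})"
    using assms by (simp add: sum.inter_filter[symmetric] sum_distrib_left)
  finally have swap: "(\<Sum>t\<in>X. s t * (\<Sum>i\<in>F. if t < d i then c i else 0))
      = (\<Sum>i\<in>F. c i * sum s {t \<in> X. t < d i})" .
  have "(\<Sum>t\<in>X. s t * (\<alpha> + \<beta> * h t)) = \<alpha> * sum s X + \<beta> * (\<Sum>t\<in>X. s t * h t)" for h
    by (simp add: distrib_left sum.distrib sum_distrib_left mult_ac)
  then show ?thesis by (simp only: swap)
qed

text \<open>The left-hand side is a layer formula for the distance to the nearest open facility,
  capped at 3 * R: the layer at \<open>t\<close> counts with a bound on the probability that nothing
  within \<open>t\<close> is open. The mass within \<open>t\<close> lies in [0, 1] before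
  \<open>R\<close> and in [1, \<gamma>] from \<open>R\<close> on; a chord bound on each range gives
  an expression linear in the distances.\<close>

lemma client_bound:
  fixes a c d :: "'f \<Rightarrow> real" and R \<gamma> :: real
  assumes F: "finite F" and ac: "\<And>i. i \<in> F \<Longrightarrow> 0 \<le> c i \<and> c i \<le> a i"
    and sum_a: "sum a F = \<gamma>" and sum_c: "sum c F = 1" and \<gamma>: "1 < \<gamma>"
    and near: "\<And>i. i \<in> F \<Longrightarrow> 0 < c i \<Longrightarrow> d i \<le> R"
    and far: "\<And>i. i \<in> F \<Longrightarrow> c i < a i \<Longrightarrow> R \<le> d i"
    and d: "\<And>i. i \<in> F \<Longrightarrow> 0 \<le> d i" and R: "0 \<le> R"
    and T: "finite T" "0 \<in> T" "R \<in> T" "3 * R \<in> T" "d ` F \<subseteq> T"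
    and cond: "exp (- 1) + 2 * exp (- \<gamma>) \<le> (1 + 2 * exp (- \<gamma>)) * ((\<gamma> - 1) / \<gamma>)"
  shows "(\<Sum>t | t \<in> T \<and> 0 \<le> t \<and> t < 3 * R. step T t * exp (- (\<Sum>i | i \<in> F \<and> d i \<le> t. a i)))
    \<le> (1 + 2 * exp (- \<gamma>)) * ((\<Sum>i\<in>F. a i * d i) / \<gamma>)"
proof -
  define E g :: real where "E = exp (- 1)" and "g = exp (- \<gamma>)"
  define W where "W t = (\<Sum>i | i \<in> F \<and> d i \<le> t. a i)" for t
  define X1 where "X1 = {t. t \<in> T \<and> 0 \<le> t \<and> t < R}"
  define X2 where "X2 = {t. t \<in> T \<and> R \<le> t \<and> t < 3 * R}"
  define dC where "dC = (\<Sum>i\<in>F. c i * d i)"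
  define dD where "dD = (\<Sum>i\<in>F. (a i - c i) * d i)"
  \<comment> \<open>The negated slope of the chord of exp (-W) between W = 1 and W =
    \<gamma>.\<close>
  define \<kappa> where "\<kappa> = (E - g) / (\<gamma> - 1)"
  have fin: "finite X1" "finite X2" using T by (auto simp: X1_def X2_def)
  have E: "E < 1" "0 < g" "g \<le> E" using \<gamma> by (auto simp: E_def g_def)
  have \<kappa>: "0 \<le> \<kappa>" "\<kappa> * (\<gamma> - 1) = E - g" using E \<gamma> by (auto simp: \<kappa>_def)
  have W_split: "W t = \<gamma> - (\<Sum>i\<in>F. if t < d i then a i else 0)" for t
  proof -
    have "sum a F = (\<Sum>i\<in>F. (if d i \<le> t then a i else 0) + (if t < d i then a i else 0))"
      by (rule sum.cong) auto
    also have "\<dots> = W t + (\<Sum>i\<in>F. if t < d i then a i else 0)"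
      using F by (simp add: sum.distrib W_def sum.If_cases Int_def)
    finally show ?thesis using sum_a by simp
  qed
  \<comment> \<open>A facility not entirely close has distance at least \<open>R\<close>, so all
    distant mass, \<gamma> - 1 in total, lies beyond \<open>t\<close>.\<close>
  have near_W: "W t = 1 - (\<Sum>i\<in>F. if t < d i then c i else 0)" if "t < R" for t
  proof -
    have "(\<Sum>i\<in>F. if t < d i then a i else 0)
        = (\<Sum>i\<in>F. (a i - c i) + (if t < d i then c i else 0))"
    proof (rule sum.cong)
      fix i assume i: "i \<in> F"
      show "(if t < d i then a i else 0) = a i - c i + (if t < d i then c i else 0)"
        using far[OF i] ac[OF i] that by (cases "c i < a i") auto
    qed simp
    then show ?thesis using sum_a sum_c by (simp add: W_split sum.distrib sum_subtractf)
  qed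
  \<comment> \<open>All close mass is within \<open>R\<close>, so only distant mass can lie beyond
    \<open>t\<close>.\<close>
  have far_W: "W t = \<gamma> - (\<Sum>i\<in>F. if t < d i then a i - c i else 0)" if "R \<le> t" for t
  proof -
    have "(\<Sum>i\<in>F. if t < d i then a i else 0) = (\<Sum>i\<in>F. if t < d i then a i - c i else 0)"
    proof (rule sum.cong)
      fix i assume i: "i \<in> F"
      show "(if t < d i then a i else 0) = (if t < d i then a i - c i else 0)"
        using near[OF i] ac[OF i] that by (cases "0 < c i") auto
    qed simp
    then show ?thesis by (simp add: W_split)
  qed
  have W0: "0 \<le> W t" for t
    unfolding W_def using ac by (intro sum_nonneg) force
  have near_exp: "exp (- W t) \<le> E + (1 - E) * (\<Sum>i\<in>F. if t < d i then c i else 0)" if "t < R" for t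
  proof -
    have "0 \<le> (\<Sum>i\<in>F. if t < d i then c i else 0)" using ac by (intro sum_nonneg) auto
    then have "W t \<le> 1" using near_W[OF that] by simp
    from exp_uminus_le_chord[OF W0 this]
    have "exp (- W t) \<le> (1 - W t) + W t * E" by (simp add: E_def)
    then show ?thesis by (simp add: near_W[OF that] algebra_simps)
  qed
  have far_exp: "exp (- W t) \<le> g + \<kappa> * (\<Sum>i\<in>F. if t < d i then a i - c i else 0)" if "R \<le> t" for t
  proof -
    let ?s = "\<Sum>i\<in>F. if t < d i then a i - c i else 0"
    have "0 \<le> ?s" using ac by (intro sum_nonneg) auto
    moreover have "?s \<le> (\<Sum>i\<in>F. a i - c i)" using ac by (intro sum_mono) auto
    ultimately have W: "1 \<le> W t" "W t \<le> \<gamma>"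
      using far_W[OF that] sum_a sum_c by (auto simp: sum_subtractf)
    have "(\<gamma> - 1) * exp (- W t) \<le> (\<gamma> - W t) * E + (W t - 1) * g"
      unfolding E_def g_def by (rule exp_uminus_le_chord[OF W])
    also have "\<dots> = (\<gamma> - W t) * (E - g) + (\<gamma> - 1) * g" by (simp add: algebra_simps)
    also have "\<dots> = (\<gamma> - 1) * (g + \<kappa> * ?s)"
      unfolding \<kappa>(2)[symmetric] far_W[OF that] by (simp add: algebra_simps)
    finally show ?thesis using \<gamma> by simp
  qed
  have st: "0 \<le> step T t" if "t < 3 * R" for t
    using step_nonneg[OF T(1,4) that] .
  have "(\<Sum>t\<in>X1. step T t * exp (- W t))
      \<le> (\<Sum>t\<in>X1. step T t * (E + (1 - E) * (\<Sum>i\<in>F. if t < d i then c i else 0)))"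
    using near_exp st R by (intro sum_mono mult_left_mono) (auto simp: X1_def)
  also have "\<dots> = E * sum (step T) X1 + (1 - E) * (\<Sum>i\<in>F. c i * sum (step T) {t \<in> X1. t < d i})"
    by (rule sum_layers[OF fin(1)])
  also have "sum (step T) X1 = R"
    unfolding X1_def using sum_step[OF T(1,2,3) R] by simp
  also have "(\<Sum>i\<in>F. c i * sum (step T) {t \<in> X1. t < d i}) = dC"
    unfolding dC_def
  proof (rule sum.cong)
    fix i assume i: "i \<in> F"
    show "c i * sum (step T) {t \<in> X1. t < d i} = c i * d i"
    proof (cases "0 < c i")
      case True
      then have "{t \<in> X1. t < d i} = {t. t \<in> T \<and> 0 \<le> t \<and> t < d i}"
        using near[OF i] by (auto simp: X1_def)
      then show ?thesis
        using sum_step[OF T(1,2) _ d[OF i]] T(5) i by auto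
    next
      case False
      then show ?thesis using ac[OF i] by simp
    qed
  qed simp
  finally have part1: "(\<Sum>t\<in>X1. step T t * exp (- W t)) \<le> E * R + (1 - E) * dC" .
  have "(\<Sum>t\<in>X2. step T t * exp (- W t))
      \<le> (\<Sum>t\<in>X2. step T t * (g + \<kappa> * (\<Sum>i\<in>F. if t < d i then a i - c i else 0)))"
    using far_exp st R by (intro sum_mono mult_left_mono) (auto simp: X2_def)
  also have "\<dots> = g * sum (step T) X2 + \<kappa> * (\<Sum>i\<in>F. (a i - c i) * sum (step T) {t \<in> X2. t < d i})"
    by (rule sum_layers[OF fin(2)])
  also have "sum (step T) X2 = 2 * R"
    unfolding X2_def using sum_step[OF T(1,3,4)] R by simp
  \<comment> \<open>Only an inequality, because \<open>X2\<close> stops at 3 * R while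
    \<open>d i\<close> may be larger.\<close>
  also have "\<kappa> * (\<Sum>i\<in>F. (a i - c i) * sum (step T) {t \<in> X2. t < d i})
      \<le> \<kappa> * (\<Sum>i\<in>F. (a i - c i) * (d i - R))"
  proof (rule mult_left_mono[OF sum_mono])
    fix i assume i: "i \<in> F"
    show "(a i - c i) * sum (step T) {t \<in> X2. t < d i} \<le> (a i - c i) * (d i - R)"
    proof (cases "c i < a i")
      case True
      have dT: "d i \<in> T" using T(5) i by auto
      have "sum (step T) {t \<in> X2. t < d i} \<le> (\<Sum>t | t \<in> T \<and> R \<le> t \<and> t < d i. step T t)"
        using T(1) step_nonneg[OF T(1) dT] by (intro sum_mono2) (auto simp: X2_def)
      also have "\<dots> = d i - R"
        by (rule sum_step[OF T(1,3) dT far[OF i True]])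
      finally show ?thesis using True by simp
    next
      case False
      then have "a i = c i" using ac[OF i] by simp
      then show ?thesis by simp
    qed
  qed (rule \<kappa>(1))
  also have "(\<Sum>i\<in>F. (a i - c i) * (d i - R)) = dD - (\<Sum>i\<in>F. a i - c i) * R"
    unfolding dD_def sum_distrib_right by (simp add: right_diff_distrib sum_subtractf)
  also have "(\<Sum>i\<in>F. a i - c i) = \<gamma> - 1"
    using sum_a sum_c by (simp add: sum_subtractf)
  finally have part2: "(\<Sum>t\<in>X2. step T t * exp (- W t)) \<le> g * (2 * R) + \<kappa> * (dD - (\<gamma> - 1) * R)"
    by simp
  \<comment> \<open>The average distance of the distant mass. The close mass is one unit with
    average \<open>dC\<close>, so \<open>dC \<le> R \<le> Z\<close>.\<close>
  define Z where "Z = dD / (\<gamma> - 1)"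
  have Z: "dD = (\<gamma> - 1) * Z" using \<gamma> by (simp add: Z_def)
  have "(\<Sum>i\<in>F. (a i - c i) * R) \<le> dD"
    unfolding dD_def
  proof (rule sum_mono)
    fix i assume i: "i \<in> F"
    show "(a i - c i) * R \<le> (a i - c i) * d i"
      using far[OF i] ac[OF i] by (cases "c i < a i") auto
  qed
  then have "R * (\<gamma> - 1) \<le> dD" using sum_a sum_c
    by (simp add: sum_subtractf mult.commute[of R] flip: sum_distrib_right)
  then have RZ: "R \<le> Z" using \<gamma> by (simp add: Z_def field_simps)
  have "dC \<le> (\<Sum>i\<in>F. c i * R)"
    unfolding dC_def
  proof (rule sum_mono)
    fix i assume i: "i \<in> F"
    show "c i * d i \<le> c i * R"
      using near[OF i] ac[OF i] by (cases "0 < c i") auto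
  qed
  then have CR: "dC \<le> R" using sum_c by (simp flip: sum_distrib_right)
  have total: "(\<Sum>i\<in>F. a i * d i) = dC + (\<gamma> - 1) * Z"
    unfolding Z[symmetric] by (simp add: dC_def dD_def left_diff_distrib sum_subtractf)
  have split: "{t. t \<in> T \<and> 0 \<le> t \<and> t < 3 * R} = X1 \<union> X2" using R by (auto simp: X1_def X2_def)
  have "(\<Sum>t | t \<in> T \<and> 0 \<le> t \<and> t < 3 * R. step T t * exp (- W t))
      = (\<Sum>t\<in>X1. step T t * exp (- W t)) + (\<Sum>t\<in>X2. step T t * exp (- W t))"
    unfolding split by (rule sum.union_disjoint[OF fin]) (auto simp: X1_def X2_def)
  also have "\<dots> \<le> E * R + (1 - E) * dC + 2 * R * g + \<kappa> * (\<gamma> - 1) * (Z - R)"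
    using part1 part2 by (simp add: Z algebra_simps)
  also have "\<dots> = (1 - E) * dC + (E - g) * Z + 3 * g * R"
    unfolding \<kappa>(2) by (simp add: algebra_simps)
  also have "\<dots> \<le> (1 - E) * dC + (E - g) * Z + 3 * g * Z"
    using RZ E by simp
  also have "\<dots> = (1 - E) * dC + (E + 2 * g) * Z" by (simp add: algebra_simps)
  also have "\<dots> \<le> (1 + 2 * g) * ((dC + (\<gamma> - 1) * Z) / \<gamma>)"
  proof -
    \<comment> \<open>On both sides the coefficients of \<open>dC\<close> and \<open>Z\<close> add
      up to 1 + 2 * g, so the difference is a multiple of \<open>Z - dC\<close>; \<open>cond\<close>
      says that its factor is nonnegative.\<close>
    define k where "k = (1 + 2 * g) * ((\<gamma> - 1) / \<gamma>) - (E + 2 * g)"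
    have "0 \<le> k * (Z - dC)"
      using cond CR RZ by (intro mult_nonneg_nonneg) (auto simp: k_def E_def g_def)
    also have "\<dots> = (1 + 2 * g) * ((dC + (\<gamma> - 1) * Z) / \<gamma>) - ((1 - E) * dC + (E + 2 * g) * Z)"
      using \<gamma> by (simp add: k_def field_simps)
    finally show ?thesis by simp
  qed
  finally show ?thesis unfolding total W_def g_def .
qed

section \<open>Splitting facilities into pieces and rounding the UFL relaxation\<close>

text \<open>The pieces of facility \<open>i\<close> below the breakpoint \<open>b i\<close> have
  total weight \<open>b i\<close>. This evaluates opening, close and assigned mass alike.\<close>

lemma sum_step_Sigma:
  fixes T :: "'f \<Rightarrow> real set"
  assumes "finite G" "\<And>i. i \<in> G \<Longrightarrow> finite (T i) \<and> 0 \<in> T i \<and> b i \<in> T i \<and> 0 \<le> b i"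
  shows "(\<Sum>p\<in>(SIGMA i:G. {t \<in> T i. 0 \<le> t \<and> t < b i}). step (T (fst p)) (snd p) * h (fst p))
    = (\<Sum>i\<in>G. b i * h i)"
proof -
  have "(\<Sum>p\<in>(SIGMA i:G. {t \<in> T i. 0 \<le> t \<and> t < b i}). step (T (fst p)) (snd p) * h (fst p))
      = (\<Sum>i\<in>G. \<Sum>t | t \<in> T i \<and> 0 \<le> t \<and> t < b i. step (T i) t * h i)"
    using assms by (subst sum.Sigma) (auto simp: case_prod_beta)
  also have "\<dots> = (\<Sum>i\<in>G. b i * h i)"
  proof (rule sum.cong)
    fix i assume "i \<in> G"
    then show "(\<Sum>t | t \<in> T i \<and> 0 \<le> t \<and> t < b i. step (T i) t * h i) = b i * h i"
      using sum_step[of "T i" 0 "b i"] assms(2) by (simp flip: sum_distrib_right)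
  qed simp
  finally show ?thesis .
qed

text \<open>A label \<open>(j, t)\<close> carries the length of the distance layer of client
  \<open>j\<close> at \<open>t\<close> as its penalty. The unhit labels of a client then bound its
  connection cost, \<open>round_blocks\<close> bounds the total, and \<open>client_bound\<close>
  evaluates it client by client.\<close>

lemma ufl_lp_rounding_exists:
  fixes U :: "('f, 'c) ufl" and \<gamma> :: real
  assumes U: "ufl_instance U" and xy: "ufl_lp_feasible U x y" and \<gamma>: "1 < \<gamma>"
    and cond: "exp (- 1) + 2 * exp (- \<gamma>) \<le> (1 + 2 * exp (- \<gamma>)) * ((\<gamma> - 1) / \<gamma>)"
  shows "\<exists>s. ufl_solution U s \<and> ufl_cost U s
    \<le> \<gamma> * (\<Sum>i\<in>ufl_F U. ufl_f U i * y i)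
      + (1 + 2 * exp (- \<gamma>)) * (\<Sum>i\<in>ufl_F U. \<Sum>j\<in>ufl_C U. ufl_d U i j * x i j)"
proof -
  define F where "F = ufl_F U"
  define V where "V = ufl_C U"
  define f where "f = ufl_f U"
  define d where "d = ufl_d U"
  have fin: "finite F" "finite V" and f: "\<And>i. i \<in> F \<Longrightarrow> 0 \<le> f i"
    and d: "\<And>i j. i \<in> F \<Longrightarrow> j \<in> V \<Longrightarrow> 0 \<le> d i j"
    and four_point: "\<And>i i' j j'. i \<in> F \<Longrightarrow> i' \<in> F \<Longrightarrow> j \<in> V \<Longrightarrow> j' \<in> V
      \<Longrightarrow> d i j \<le> d i j' + d i' j' + d i' j"
    using U by (auto simp: ufl_instance_def F_def V_def f_def d_def)
  have sum_x: "\<And>j. j \<in> V \<Longrightarrow> (\<Sum>i\<in>F. x i j) = 1"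
    and xy_le: "\<And>i j. i \<in> F \<Longrightarrow> j \<in> V \<Longrightarrow> x i j \<le> y i"
    and x0: "\<And>i j. i \<in> F \<Longrightarrow> j \<in> V \<Longrightarrow> 0 \<le> x i j"
    and y0: "\<And>i. i \<in> F \<Longrightarrow> 0 \<le> y i"
    using xy by (auto simp: ufl_lp_feasible_def F_def V_def)
  define a where "a j i = \<gamma> * x i j" for j i
  have sum_a: "sum (a j) F = \<gamma>" if "j \<in> V" for j
    using sum_x[OF that] by (simp add: a_def flip: sum_distrib_left)
  have a0: "0 \<le> a j i" if "i \<in> F" "j \<in> V" for i j using x0 that \<gamma> by (simp add: a_def)
  \<comment> \<open>After scaling, client \<open>j\<close> has mass \<gamma> > 1, enough to single
    out its closest unit.\<close>
  have "\<forall>j\<in>V. \<exists>R c. R \<in> (\<lambda>i. d i j) ` F \<and> (\<forall>i\<in>F. 0 \<le> c i \<and> c i \<le> a j i) \<and> sum c F = 1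
    \<and> (\<forall>i\<in>F. 0 < c i \<longrightarrow> d i j \<le> R) \<and> (\<forall>i\<in>F. c i < a j i \<longrightarrow> R \<le> d i j)"
    using close_facilities[OF fin(1), of "a _" 1] a0 sum_a \<gamma> by (metis less_imp_le zero_less_one)
  then obtain R c where Rc: "\<And>j. j \<in> V \<Longrightarrow> R j \<in> (\<lambda>i. d i j) ` F
      \<and> (\<forall>i\<in>F. 0 \<le> c j i \<and> c j i \<le> a j i) \<and> sum (c j) F = 1
      \<and> (\<forall>i\<in>F. 0 < c j i \<longrightarrow> d i j \<le> R j) \<and> (\<forall>i\<in>F. c j i < a j i \<longrightarrow> R j \<le> d i j)"
    by metis
  have R0: "0 \<le> R j" if "j \<in> V" for j using Rc[OF that] d that by auto
  have c0: "0 \<le> c j i" "c j i \<le> a j i" if "i \<in> F" "j \<in> V" for i j using Rc that by auto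
  have near: "d i j \<le> R j" if "i \<in> F" "j \<in> V" "0 < c j i" for i j using Rc that by auto
  define Y where "Y i = \<gamma> * y i" for i
  have aY: "a j i \<le> Y i" if "i \<in> F" "j \<in> V" for i j
    using xy_le[OF that] \<gamma> by (simp add: a_def Y_def)
  \<comment> \<open>Facility \<open>i\<close> is split into pieces \<open>(i, t)\<close>, one for each gap between consecutive breakpoints
    \<open>t\<close> in \<open>[0, \<gamma> y i]\<close>.\<close>
  define T where "T i = {0, Y i} \<union> (\<lambda>j. a j i) ` V \<union> (\<lambda>j. c j i) ` V" for i
  define w where "w p = step (T (fst p)) (snd p)" for p
  define pieces where "pieces b = (SIGMA i:F. {t \<in> T i. 0 \<le> t \<and> t < b i})" for b :: "'f \<Rightarrow> real"
  define P where "P = pieces Y"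
  \<comment> \<open>Since every \<open>a j i\<close> and \<open>c j i\<close> is a breakpoint, the
    close mass \<open>N j\<close> and the assigned mass of \<open>j\<close> are exact unions of
    pieces. \<open>B (j, t)\<close> holds the assigned pieces within distance
    \<open>t\<close>.\<close>
  define N where "N j = pieces (c j)" for j
  define B where "B = (\<lambda>(j, t). {p \<in> pieces (a j). d (fst p) j \<le> t})"
  have T: "finite (T i)" "0 \<in> T i" "Y i \<in> T i" "j \<in> V \<Longrightarrow> a j i \<in> T i" "j \<in> V \<Longrightarrow> c j i \<in> T i" for i j
    using fin by (auto simp: T_def)
  have Y0: "0 \<le> Y i" if "i \<in> F" for i using y0[OF that] \<gamma> by (simp add: Y_def)
  have finP: "finite P" unfolding P_def pieces_def using fin T by auto
  have NP: "N j \<subseteq> P" if "j \<in> V" for j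
    using c0 aY that unfolding N_def P_def pieces_def by fastforce
  have AP: "pieces (a j) \<subseteq> P" if "j \<in> V" for j
    using aY that unfolding P_def pieces_def by fastforce
  have w0: "0 \<le> w p" if "p \<in> P" for p
    using that step_nonneg[OF T(1,3)] by (auto simp: w_def P_def pieces_def)
  have wN: "sum w (N j) = 1" if "j \<in> V" for j
    using sum_step_Sigma[OF fin(1), of T "c j" "\<lambda>_. 1"] T that c0 Rc
    by (simp add: N_def pieces_def w_def)
  have wP: "(\<Sum>p\<in>P. w p * f (fst p)) = \<gamma> * (\<Sum>i\<in>F. f i * y i)"
    using sum_step_Sigma[OF fin(1), of T Y f] T Y0
    by (simp add: P_def pieces_def w_def Y_def sum_distrib_left mult_ac)
  have wB: "sum w (B (j, t) \<inter> P) = (\<Sum>i | i \<in> F \<and> d i j \<le> t. a j i)" if "j \<in> V" for j t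
  proof -
    have "B (j, t) \<inter> P = (SIGMA i:{i \<in> F. d i j \<le> t}. {s \<in> T i. 0 \<le> s \<and> s < a j i})"
      using AP[OF that] by (auto simp: B_def pieces_def)
    then show ?thesis
      using sum_step_Sigma[of "{i \<in> F. d i j \<le> t}" T "a j" "\<lambda>_. 1"] T that a0 fin
      by (simp add: w_def)
  qed
  have "N j \<noteq> {}" if "j \<in> V" for j using wN[OF that] by auto
  then obtain D where D: "D \<subseteq> V" "disjoint_family_on N D"
    "\<forall>j\<in>V. \<exists>k\<in>D. R k \<le> R j \<and> N j \<inter> N k \<noteq> {}"
    using greedy_clustering[OF fin(2), of N R] by blast
  \<comment> \<open>Each cluster is a block of weight one, so it receives an open piece; every piece
    outside the clusters is a block of its own.\<close>
  define \<K> where "\<K> = N ` D \<union> (\<lambda>p. {p}) ` (P - \<Union>(N ` D))"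
  have UK: "\<Union>\<K> = P" using NP D(1) by (auto simp: \<K>_def)
  define T' where "T' j = {0, R j, 3 * R j} \<union> (\<lambda>i. d i j) ` F" for j
  define X where "X j = {t. t \<in> T' j \<and> 0 \<le> t \<and> t < 3 * R j}" for j
  have T': "finite (T' j)" "0 \<in> T' j" "R j \<in> T' j" "3 * R j \<in> T' j" "(\<lambda>i. d i j) ` F \<subseteq> T' j" for j
    using fin by (auto simp: T'_def)
  have finX: "finite (X j)" for j using T' by (auto simp: X_def)
  define u where "u = (\<lambda>(j, t). step (T' j) t)"
  have "\<exists>S\<subseteq>\<Union>\<K>. (\<forall>K\<in>\<K>. sum w K = 1 \<longrightarrow> S \<inter> K \<noteq> {}) \<and>
    sum (f \<circ> fst) S + (\<Sum>l\<in>Sigma V X. if S \<inter> B l = {} then u l else 0)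
      \<le> (\<Sum>p\<in>\<Union>\<K>. w p * (f \<circ> fst) p) + (\<Sum>l\<in>Sigma V X. u l * exp (- sum w (B l \<inter> \<Union>\<K>)))"
  proof (rule round_blocks)
    show "finite \<K>" using finP finite_subset[OF D(1) fin(2)] by (simp add: \<K>_def)
    show "finite (Sigma V X)" using fin finX by auto
    show "finite K" if "K \<in> \<K>" for K
      using that finP UK by (meson Union_upper finite_subset)
    show "disjoint \<K>"
      using D(2) disjoint_family_on_disjoint_image[OF D(2)]
      unfolding \<K>_def disjoint_def by auto
    show "sum w K = 1 \<or> (\<exists>p. K = {p})" if "K \<in> \<K>" for K
      using that wN D(1) by (auto simp: \<K>_def)
    show "0 \<le> w p" if "p \<in> \<Union>\<K>" for p using that w0 UK by simp
    show "0 \<le> (f \<circ> fst) p" if "p \<in> \<Union>\<K>" for p using that f unfolding UK by (auto simp: P_def pieces_def)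
    show "0 \<le> u l" if "l \<in> Sigma V X" for l
      using that step_nonneg[OF T'(1,4)] by (auto simp: u_def X_def)
  qed
  then obtain S where S: "S \<subseteq> P" "\<forall>K\<in>\<K>. sum w K = 1 \<longrightarrow> S \<inter> K \<noteq> {}"
    "sum (f \<circ> fst) S + (\<Sum>l\<in>Sigma V X. if S \<inter> B l = {} then u l else 0)
      \<le> (\<Sum>p\<in>P. w p * f (fst p)) + (\<Sum>l\<in>Sigma V X. u l * exp (- sum w (B l \<inter> P)))"
    unfolding UK by auto
  have finS: "finite S" using S finP finite_subset by blast
  have SF: "fst ` S \<subseteq> F" using S(1) by (auto simp: P_def pieces_def)
  have "\<exists>i\<in>fst ` S. d i j \<le> (\<Sum>t\<in>X j. if S \<inter> B (j, t) = {} then u (j, t) else 0)"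
    if j: "j \<in> V" for j
  proof -
    \<comment> \<open>The distances from \<open>j\<close> to the open pieces assigned to it, with 3
      * R j added as a fallback that is always attainable.\<close>
    define Q where "Q = insert (3 * R j) ((\<lambda>p. d (fst p) j) ` (S \<inter> pieces (a j)))"
    define q where "q = Min Q"
    have finQ: "finite Q" using finS by (simp add: Q_def)
    have qQ: "q \<in> Q" unfolding q_def by (rule Min_in[OF finQ]) (simp add: Q_def)
    have q_le: "q \<le> z" if "z \<in> Q" for z using that finQ by (simp add: q_def)
    have q3: "q \<le> 3 * R j" by (rule q_le) (simp add: Q_def)
    have qT: "q \<in> T' j" using qQ SF by (auto simp: Q_def T'_def)
    have q0: "0 \<le> q" using qQ SF d j R0[OF j] by (auto simp: Q_def)
    have empty: "S \<inter> B (j, t) = {}" if "t < q" for t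
    proof (rule ccontr)
      assume "S \<inter> B (j, t) \<noteq> {}"
      then obtain p where "p \<in> S \<inter> pieces (a j)" "d (fst p) j \<le> t" by (auto simp: B_def)
      then have "q \<le> t" using q_le[of "d (fst p) j"] by (force simp: Q_def)
      then show False using that by simp
    qed
    have "q = (\<Sum>t | t \<in> T' j \<and> 0 \<le> t \<and> t < q. step (T' j) t)"
      using sum_step[OF T'(1,2) qT q0] by simp
    \<comment> \<open>No label below \<open>q\<close> is hit, so every layer below \<open>q\<close>
      pays its full length.\<close>
    also have "\<dots> = (\<Sum>t | t \<in> T' j \<and> 0 \<le> t \<and> t < q. if S \<inter> B (j, t) = {} then u (j, t) else 0)"
      using empty by (intro sum.cong) (auto simp: u_def)
    also have "\<dots> \<le> (\<Sum>t\<in>X j. if S \<inter> B (j, t) = {} then u (j, t) else 0)"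
      using finX q3 step_nonneg[OF T'(1,4)] by (intro sum_mono2) (auto simp: X_def u_def)
    finally have q: "q \<le> (\<Sum>t\<in>X j. if S \<inter> B (j, t) = {} then u (j, t) else 0)" .
    have "\<exists>i\<in>fst ` S. d i j \<le> q"
    proof (cases "q = 3 * R j")
      case False
      then show ?thesis using qQ by (auto simp: Q_def)
    next
      case True
      \<comment> \<open>The detour through the centre: an open \<open>i'\<close> near
        \<open>k\<close> and a shared close facility \<open>i\<close> give
        \<open>d i' j \<le> d i' k + d i k + d i j\<close>, which is at most
        \<open>2 * R k + R j \<le> 3 * R j\<close>.\<close>
      obtain k where k: "k \<in> D" "R k \<le> R j" "N j \<inter> N k \<noteq> {}" using D(3) j by blast
      then have kV: "k \<in> V" using D by blast
      obtain i s where i: "(i, s) \<in> N j" "(i, s) \<in> N k" using k by auto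
      have "S \<inter> N k \<noteq> {}" using S(2) wN[OF kV] k(1) by (simp add: \<K>_def)
      then obtain i' s' where i': "(i', s') \<in> S" "(i', s') \<in> N k" by auto
      have F: "i \<in> F" "i' \<in> F" using i i' by (auto simp: N_def pieces_def)
      have "d i j \<le> R j" "d i k \<le> R k" "d i' k \<le> R k"
        using i i' near[OF F(1) j] near[OF F(1) kV] near[OF F(2) kV] by (auto simp: N_def pieces_def)
      then have "d i' j \<le> q" using four_point[OF F(2,1) j kV] k(2) True by simp
      then show ?thesis using i'(1) by force
    qed
    then show ?thesis using q by force
  qed
  then have "\<forall>j\<in>V. \<exists>i. i \<in> fst ` S
      \<and> d i j \<le> (\<Sum>t\<in>X j. if S \<inter> B (j, t) = {} then u (j, t) else 0)" by blast
  from bchoice[OF this] obtain \<sigma> where \<sigma>: "\<And>j. j \<in> V \<Longrightarrow> \<sigma> j \<in> fst ` S"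
    "\<And>j. j \<in> V \<Longrightarrow> d (\<sigma> j) j \<le> (\<Sum>t\<in>X j. if S \<inter> B (j, t) = {} then u (j, t) else 0)"
    by blast
  have sol: "ufl_solution U (fst ` S, \<sigma>)"
    using SF \<sigma> by (auto simp: ufl_solution_def F_def V_def)
  have "ufl_cost U (fst ` S, \<sigma>) = sum f (fst ` S) + (\<Sum>j\<in>V. d (\<sigma> j) j)"
    by (simp add: ufl_cost_def f_def d_def V_def)
  \<comment> \<open>Several open pieces may belong to one facility, whose opening cost is then paid
    only once.\<close>
  also have "\<dots> \<le> sum (f \<circ> fst) S
      + (\<Sum>j\<in>V. \<Sum>t\<in>X j. if S \<inter> B (j, t) = {} then u (j, t) else 0)"
    using finS f SF \<sigma> by (intro add_mono sum_mono sum_image_le) auto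
  also have "(\<Sum>j\<in>V. \<Sum>t\<in>X j. if S \<inter> B (j, t) = {} then u (j, t) else 0)
      = (\<Sum>l\<in>Sigma V X. if S \<inter> B l = {} then u l else 0)"
    using fin finX by (subst sum.Sigma) (auto intro!: sum.cong)
  also have "sum (f \<circ> fst) S + \<dots>
      \<le> \<gamma> * (\<Sum>i\<in>F. f i * y i) + (\<Sum>l\<in>Sigma V X. u l * exp (- sum w (B l \<inter> P)))"
    using S(3) wP by simp
  also have "(\<Sum>l\<in>Sigma V X. u l * exp (- sum w (B l \<inter> P)))
      = (\<Sum>j\<in>V. \<Sum>t\<in>X j. u (j, t) * exp (- sum w (B (j, t) \<inter> P)))"
    using fin finX by (subst sum.Sigma) (auto simp: case_prod_beta)
  also have "\<dots> \<le> (\<Sum>j\<in>V. (1 + 2 * exp (- \<gamma>)) * (\<Sum>i\<in>F. d i j * x i j))"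
  proof (rule sum_mono)
    fix j assume j: "j \<in> V"
    have "(\<Sum>t\<in>X j. u (j, t) * exp (- sum w (B (j, t) \<inter> P)))
        = (\<Sum>t\<in>X j. step (T' j) t * exp (- (\<Sum>i | i \<in> F \<and> d i j \<le> t. a j i)))"
      using wB[OF j] by (simp add: u_def)
    also have "\<dots> \<le> (1 + 2 * exp (- \<gamma>)) * ((\<Sum>i\<in>F. a j i * d i j) / \<gamma>)"
      unfolding X_def
      by (rule client_bound[where c = "c j" and R = "R j"])
        (use fin T' Rc[OF j] sum_a[OF j] \<gamma> R0[OF j] d j cond in auto)
    also have "(\<Sum>i\<in>F. a j i * d i j) / \<gamma> = (\<Sum>i\<in>F. d i j * x i j)"
      using \<gamma> by (simp add: a_def sum_divide_distrib mult.commute)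
    finally show "(\<Sum>t\<in>X j. u (j, t) * exp (- sum w (B (j, t) \<inter> P)))
        \<le> (1 + 2 * exp (- \<gamma>)) * (\<Sum>i\<in>F. d i j * x i j)" .
  qed
  also have "\<dots> = (1 + 2 * exp (- \<gamma>)) * (\<Sum>i\<in>F. \<Sum>j\<in>V. d i j * x i j)"
    by (subst sum.swap) (simp add: sum_distrib_left)
  finally have "ufl_cost U (fst ` S, \<sigma>) \<le> \<gamma> * (\<Sum>i\<in>F. f i * y i)
      + (1 + 2 * exp (- \<gamma>)) * (\<Sum>i\<in>F. \<Sum>j\<in>V. d i j * x i j)" by simp
  with sol show ?thesis unfolding F_def V_def f_def d_def by blast
qed

section \<open>From facility location to matchings\<close>

lemma finite_flm_E: "flm_instance I \<Longrightarrow> finite (flm_E I)"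
  by (rule finite_subset[of _ "Pow (flm_V I)"]) (auto simp: flm_instance_def)

lemma card_Union_matching:
  assumes "finite V" "E \<subseteq> {e. e \<subseteq> V \<and> card e = 2}" "matching E M"
  shows "card (\<Union>M) = 2 * card M"
proof -
  have "card (\<Union>M) = (\<Sum>e\<in>M. card e)"
    by (rule card_Union_disjoint)
      (use assms in \<open>auto simp: matching_def pairwise_def disjnt_def intro: finite_subset\<close>)
  also have "\<dots> = (\<Sum>e\<in>M. 2)" using assms by (intro sum.cong) (auto simp: matching_def)
  finally show ?thesis by simp
qed

text \<open>A matching covers twice as many vertices as it has edges. Since some matching covers
  \<open>V\<close>, the maximum size is half of \<open>card V\<close> and is reached exactly by
  covering \<open>V\<close>.\<close>

lemma maximum_matching_iff_perfect:
  assumes "I \<in> pm_instances"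
  shows "maximum_matching (flm_E I) M \<longleftrightarrow> perfect_matching (flm_V I) (flm_E I) M"
proof -
  define E where "E = flm_E I"
  define V where "V = flm_V I"
  have V: "finite V" and E: "E \<subseteq> {e. e \<subseteq> V \<and> card e = 2}"
    using assms by (auto simp: pm_instances_def flm_instance_def V_def E_def)
  obtain M0 where M0: "matching E M0" "\<Union>M0 = V"
    using assms by (auto simp: pm_instances_def perfectly_matchable_def perfect_matching_def E_def V_def)
  have sub: "\<Union>M' \<subseteq> V" if "matching E M'" for M'
    using that E by (auto simp: matching_def)
  have card: "card (\<Union>M') = 2 * card M'" if "matching E M'" for M'
    using card_Union_matching[OF V E that] .
  have "\<Union>M = V" if "maximum_matching E M"
  proof (rule card_subset_eq[OF V])
    have M: "matching E M" "card M0 \<le> card M" using that M0 by (auto simp: maximum_matching_def)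
    show "\<Union>M \<subseteq> V" using sub M by simp
    then have "card (\<Union>M) \<le> card V" using V by (simp add: card_mono)
    then show "card (\<Union>M) = card V" using card[OF M(1)] card[OF M0(1)] M(2) M0(2) by simp
  qed
  moreover have "card M' \<le> card M" if "perfect_matching V E M" "matching E M'" for M'
  proof -
    have "card (\<Union>M') \<le> card V" using sub[OF that(2)] V by (simp add: card_mono)
    then show ?thesis using that card[OF that(2)] card[of M] by (simp add: perfect_matching_def)
  qed
  ultimately have "maximum_matching E M \<longleftrightarrow> perfect_matching V E M"
    by (auto simp: maximum_matching_def perfect_matching_def)
  then show ?thesis by (simp add: E_def V_def)
qed

lemma sum_perfect_matching:
  fixes h :: "'v \<Rightarrow> real"
  assumes "finite V" "perfect_matching V E M"
  shows "(\<Sum>e\<in>M. \<Sum>v\<in>e. h v) = (\<Sum>v\<in>V. h v)"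
proof -
  have "(\<Sum>v\<in>\<Union>M. h v) = (\<Sum>e\<in>M. \<Sum>v\<in>e. h v)"
    by (subst sum.Union_disjoint)
      (use assms in \<open>auto simp: perfect_matching_def matching_def intro: finite_subset\<close>)
  then show ?thesis using assms by (simp add: perfect_matching_def)
qed

lemma perfect_matching_degree:
  assumes "finite E" "perfect_matching V E M" "v \<in> V"
  shows "(\<Sum>e\<in>incident E v. indicator M e) = (1::real)"
proof -
  obtain e where e: "e \<in> M" "v \<in> e" using assms by (auto simp: perfect_matching_def)
  have "incident E v \<inter> M = {e}"
    using assms(2) e unfolding perfect_matching_def matching_def incident_def by blast
  moreover have "finite (incident E v)" using assms(1) by (simp add: incident_def)
  ultimately show ?thesis by (simp add: indicator_def sum.If_cases)
qed

section \<open>A fixed perfectly matchable instance\<close>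

locale pm_instance =
  fixes I :: "'a flm"
  assumes pm: "I \<in> pm_instances"
begin

abbreviation "F \<equiv> flm_F I"
abbreviation "V \<equiv> flm_V I"
abbreviation "E \<equiv> flm_E I"
abbreviation "f \<equiv> flm_f I"
abbreviation "d \<equiv> flm_d I"

lemma inst: "flm_instance I" using pm by (simp add: pm_instances_def)

lemma finite_sets: "finite F" "finite V" "finite E"
  using inst finite_flm_E[OF inst] by (auto simp: flm_instance_def)

lemma f_nonneg: "i \<in> F \<Longrightarrow> 0 \<le> f i" using inst by (auto simp: flm_instance_def)

lemma edge:
  assumes "e \<in> E"
  obtains j k where "e = {j, k}" "j \<noteq> k" "j \<in> V" "k \<in> V"
proof -
  have "card e = 2" "e \<subseteq> V" using inst assms by (auto simp: flm_instance_def)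
  then show thesis using that by (auto simp: card_2_iff)
qed

lemma edge_subset: "e \<in> E \<Longrightarrow> e \<subseteq> V" by (auto elim!: edge)

sublocale Metric_space "F \<union> V" d using inst by (simp add: flm_instance_def)

lemma dist_edge_nonneg: "0 \<le> dist_edge I i e" by (simp add: dist_edge_def sum_nonneg)

lemma ufl_instance: "ufl_instance (flm_to_ufl I)"
proof -
  \<comment> \<open>Two triangle inequalities along the path from \<open>i\<close> over
    \<open>j'\<close> and \<open>i'\<close> to \<open>j\<close>.\<close>
  have "d i j \<le> d i j' + d i' j' + d i' j" if "i \<in> F" "i' \<in> F" "j \<in> V" "j' \<in> V" for i i' j j'
    using that triangle[of i j' j] triangle[of j' i' j] by (simp add: commute)
  then show ?thesis using finite_sets f_nonneg by (simp add: ufl_instance_def flm_to_ufl_def)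
qed

section \<open>Edge lengths and service by open facilities\<close>

text \<open>Half the sum over ordered pairs avoids choosing endpoints: the diagonal vanishes and
  each edge is counted twice.\<close>

definition len :: "'a set \<Rightarrow> real" where
  "len e = (\<Sum>u\<in>e. \<Sum>v\<in>e. d u v) / 2"

lemma len_edge:
  assumes "j \<noteq> k" "j \<in> V" "k \<in> V"
  shows "len {j, k} = d j k"
  using assms by (simp add: len_def commute)

lemma len_le_dist_edge:
  assumes "e \<in> E" "i \<in> F"
  shows "len e \<le> dist_edge I i e"
  using assms(1)
proof (rule edge)
  fix j k assume e: "e = {j, k}" "j \<noteq> k" "j \<in> V" "k \<in> V"
  then show ?thesis using triangle[of j i k] assms(2) by (simp add: len_edge dist_edge_def commute)
qed

text \<open>Serving \<open>{j, k}\<close> from \<open>\<sigma> j\<close> costs at most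
  \<open>2 * d (\<sigma> j) j + d j k\<close>, and symmetrically for \<open>\<sigma> k\<close>. The
  cheaper choice is at most the average of the two bounds.\<close>

lemma dist_set_edge_le:
  assumes "e \<in> E" "S \<subseteq> F" "\<sigma> \<in> V \<rightarrow> S"
  shows "dist_set_edge I S e \<le> (\<Sum>v\<in>e. d (\<sigma> v) v) + len e"
  using assms(1)
proof (rule edge)
  fix j k assume e: "e = {j, k}" "j \<noteq> k" "j \<in> V" "k \<in> V"
  have S: "\<sigma> j \<in> S" "\<sigma> k \<in> S" using assms(3) e by auto
  have "dist_set_edge I S e \<le> dist_edge I i e" if "i \<in> S" for i
    unfolding dist_set_edge_def using that finite_subset[OF assms(2)] finite_sets by (intro Min_le) auto
  then have "dist_set_edge I S e \<le> d (\<sigma> j) j + d (\<sigma> j) k" "dist_set_edge I S e \<le> d (\<sigma> k) j + d (\<sigma> k) k"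
    using S e by (auto simp: dist_edge_def)
  moreover have "d (\<sigma> j) k \<le> d (\<sigma> j) j + d j k" "d (\<sigma> k) j \<le> d (\<sigma> k) k + d j k"
    using triangle[of "\<sigma> j" j k] triangle[of "\<sigma> k" k j] S assms(2) e by (auto simp: commute)
  ultimately show ?thesis using e by (simp add: len_edge)
qed

section \<open>The matching polytope and the induced UFL relaxation\<close>

lemma P_MM_witness:
  assumes "z \<in> P_MM E"
  obtains \<mu> where "\<And>M. perfect_matching V E M \<Longrightarrow> 0 \<le> \<mu> M"
    "(\<Sum>M | perfect_matching V E M. \<mu> M) = 1"
    "\<And>e. e \<in> E \<Longrightarrow> z e = (\<Sum>M | perfect_matching V E M. \<mu> M * indicator M e)"
  using assms unfolding P_MM_def maximum_matching_iff_perfect[OF pm] by auto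

lemma finite_perfect_matchings: "finite {M. perfect_matching V E M}"
  by (rule finite_subset[of _ "Pow E"]) (use finite_sets in \<open>auto simp: perfect_matching_def matching_def\<close>)

text \<open>Every perfect matching has degree one at \<open>j\<close>, a property that convex
  combinations inherit. It yields the assignment constraint of the UFL relaxation.\<close>

lemma P_MM_degree:
  assumes "z \<in> P_MM E" "j \<in> V"
  shows "(\<Sum>e\<in>incident E j. z e) = 1"
proof -
  obtain \<mu> where \<mu>: "(\<Sum>M | perfect_matching V E M. \<mu> M) = 1"
    "\<And>e. e \<in> E \<Longrightarrow> z e = (\<Sum>M | perfect_matching V E M. \<mu> M * indicator M e)"
    by (rule P_MM_witness[OF assms(1)]) blast
  have "(\<Sum>e\<in>incident E j. z e)
      = (\<Sum>e\<in>incident E j. \<Sum>M | perfect_matching V E M. \<mu> M * indicator M e)"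
    using \<mu>(2) by (intro sum.cong) (auto simp: incident_def)
  also have "\<dots> = (\<Sum>M | perfect_matching V E M. \<mu> M * (\<Sum>e\<in>incident E j. indicator M e))"
    by (subst sum.swap) (simp add: sum_distrib_left)
  also have "\<dots> = (\<Sum>M | perfect_matching V E M. \<mu> M)"
    using perfect_matching_degree[OF finite_sets(3) _ assms(2)] by (intro sum.cong) auto
  finally show ?thesis using \<mu>(1) by simp
qed

lemma ufl_lp_feasible:
  assumes "flm_lp_feasible I (x, y)"
  shows "ufl_lp_feasible (flm_to_ufl I) (\<lambda>i j. \<Sum>e\<in>incident E j. x i e) y"
proof -
  have "(\<Sum>i\<in>F. \<Sum>e\<in>incident E j. x i e) = 1" if "j \<in> V" for j
    using P_MM_degree[OF _ that] assms by (subst sum.swap) (auto simp: flm_lp_feasible_def)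
  moreover have "0 \<le> (\<Sum>e\<in>incident E j. x i e)" if "i \<in> F" for i j
    using that assms by (intro sum_nonneg) (auto simp: flm_lp_feasible_def incident_def)
  ultimately show ?thesis using assms
    by (auto simp: ufl_lp_feasible_def flm_to_ufl_def flm_lp_feasible_def)
qed

text \<open>Double counting of the incidences between clients and edges, so the UFL solution
  inherits the LP connection cost without loss.\<close>

lemma ufl_connection_cost:
  "(\<Sum>i\<in>F. \<Sum>j\<in>V. d i j * (\<Sum>e\<in>incident E j. x i e)) = (\<Sum>i\<in>F. \<Sum>e\<in>E. dist_edge I i e * x i e)"
proof (rule sum.cong)
  fix i
  have "(\<Sum>j\<in>V. d i j * (\<Sum>e\<in>incident E j. x i e))
      = (\<Sum>j\<in>V. \<Sum>e\<in>E. if j \<in> e then d i j * x i e else 0)"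
    using finite_sets by (simp add: incident_def sum_distrib_left sum.If_cases Int_def)
  also have "\<dots> = (\<Sum>e\<in>E. \<Sum>j\<in>V. if j \<in> e then d i j * x i e else 0)"
    by (rule sum.swap)
  also have "\<dots> = (\<Sum>e\<in>E. dist_edge I i e * x i e)"
  proof (rule sum.cong)
    fix e assume "e \<in> E"
    then have "V \<inter> e = e" using edge_subset by blast
    then show "(\<Sum>j\<in>V. if j \<in> e then d i j * x i e else 0) = dist_edge I i e * x i e"
      using finite_sets by (simp add: sum.If_cases dist_edge_def sum_distrib_right)
  qed simp
  finally show "(\<Sum>j\<in>V. d i j * (\<Sum>e\<in>incident E j. x i e)) = (\<Sum>e\<in>E. dist_edge I i e * x i e)" .
qed simp

text \<open>\<open>M\<close> is picked by total length alone, without regard to \<open>S\<close> or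
  \<open>\<sigma>\<close>: its length is at most the average over the convex combination, which the
  LP connection cost dominates edge by edge. As \<open>M\<close> partitions the clients, the
  distances to \<open>\<sigma>\<close> add up to the UFL connection cost.\<close>

lemma cheap_perfect_matching:
  assumes xy: "flm_lp_feasible I (x, y)" and S: "S \<subseteq> F" "\<sigma> \<in> V \<rightarrow> S"
  shows "\<exists>M. perfect_matching V E M \<and> (\<Sum>e\<in>M. dist_set_edge I S e)
    \<le> (\<Sum>v\<in>V. d (\<sigma> v) v) + (\<Sum>i\<in>F. \<Sum>e\<in>E. dist_edge I i e * x i e)"
proof -
  have "(\<lambda>e. \<Sum>i\<in>F. x i e) \<in> P_MM E" using xy by (simp add: flm_lp_feasible_def)
  then obtain \<mu> where \<mu>: "\<And>M. perfect_matching V E M \<Longrightarrow> 0 \<le> \<mu> M"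
    "(\<Sum>M | perfect_matching V E M. \<mu> M) = 1"
    "\<And>e. e \<in> E \<Longrightarrow> (\<Sum>i\<in>F. x i e) = (\<Sum>M | perfect_matching V E M. \<mu> M * indicator M e)"
    by (rule P_MM_witness) blast
  obtain M where M: "perfect_matching V E M"
    "sum len M \<le> (\<Sum>M | perfect_matching V E M. \<mu> M * sum len M)"
    using exists_le_weighted_average[OF finite_perfect_matchings, of \<mu> "sum len"] \<mu> by auto
  have ME: "M \<subseteq> E" using M by (simp add: perfect_matching_def matching_def)
  have "(\<Sum>e\<in>M. dist_set_edge I S e) \<le> (\<Sum>e\<in>M. (\<Sum>v\<in>e. d (\<sigma> v) v) + len e)"
    using ME S by (intro sum_mono dist_set_edge_le) auto
  also have "\<dots> = (\<Sum>v\<in>V. d (\<sigma> v) v) + sum len M"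
    by (simp add: sum.distrib sum_perfect_matching[OF finite_sets(2) M(1)])
  also have "sum len M \<le> (\<Sum>M | perfect_matching V E M. \<Sum>e\<in>E. \<mu> M * indicator M e * len e)"
  proof -
    have "\<mu> N * sum len N = (\<Sum>e\<in>E. \<mu> N * indicator N e * len e)"
      if "perfect_matching V E N" for N
    proof -
      have "E \<inter> N = N" using that by (auto simp: perfect_matching_def matching_def)
      then have "sum len N = (\<Sum>e\<in>E. if e \<in> N then len e else 0)"
        using finite_sets by (simp add: sum.If_cases)
      also have "\<dots> = (\<Sum>e\<in>E. indicator N e * len e)" by (intro sum.cong) auto
      finally show ?thesis by (simp add: sum_distrib_left mult.assoc)
    qed
    then show ?thesis using M(2) by simp
  qed
  also have "\<dots> = (\<Sum>e\<in>E. (\<Sum>i\<in>F. x i e) * len e)"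
    by (subst sum.swap) (simp add: \<mu>(3) sum_distrib_right)
  also have "\<dots> = (\<Sum>i\<in>F. \<Sum>e\<in>E. len e * x i e)"
    by (subst sum.swap) (simp add: sum_distrib_left mult.commute)
  also have "\<dots> \<le> (\<Sum>i\<in>F. \<Sum>e\<in>E. dist_edge I i e * x i e)"
    using xy len_le_dist_edge by (intro sum_mono mult_right_mono) (auto simp: flm_lp_feasible_def)
  finally show ?thesis using M(1) by auto
qed

section \<open>Integral solutions as LP points\<close>

text \<open>The usual 0-1 embedding. It shows that the LP is feasible whenever a solution exists and
  that its optimum is a lower bound.\<close>

lemma flm_solution_lp_point:
  assumes "flm_solution I (S, M, \<sigma>)"
  shows "\<exists>p. flm_lp_feasible I p \<and> flm_lp_cost I p = flm_cost I (S, M, \<sigma>)"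
proof -
  have S: "S \<subseteq> F" and M: "maximum_matching E M" and \<sigma>: "\<And>e. e \<in> M \<Longrightarrow> \<sigma> e \<in> S"
    using assms by (auto simp: flm_solution_def)
  have ME: "M \<subseteq> E" using M by (simp add: maximum_matching_def matching_def)
  define x where "x i e = (if e \<in> M \<and> \<sigma> e = i then 1 else 0 :: real)" for i e
  define y where "y i = (indicator S i :: real)" for i
  have sum_x: "(\<Sum>i\<in>F. h i e * x i e) = (if e \<in> M then h (\<sigma> e) e else 0)" for h :: "'a \<Rightarrow> 'a set \<Rightarrow> real" and e
  proof (cases "e \<in> M")
    case True
    then have "\<sigma> e \<in> F" using \<sigma> S by blast
    then show ?thesis using True finite_sets by (simp add: x_def if_distrib cong: if_cong)
  qed (simp add: x_def)
  have "(\<lambda>e. \<Sum>i\<in>F. x i e) \<in> P_MM E"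
  proof -
    have fin: "finite {M. maximum_matching E M}"
      using finite_perfect_matchings by (simp add: maximum_matching_iff_perfect[OF pm])
    have "(\<Sum>i\<in>F. x i e) = (\<Sum>N\<in>{M. maximum_matching E M}. (if N = M then 1 else 0) * indicator N e)" for e
    proof -
      have "(\<Sum>N\<in>{M. maximum_matching E M}. (if N = M then 1 else 0) * indicator N e)
          = (\<Sum>N\<in>{M. maximum_matching E M}. if N = M then indicator M e else (0::real))"
        by (intro sum.cong) auto
      also have "\<dots> = indicator M e" using fin M by simp
      finally show ?thesis using sum_x[of "\<lambda>_ _. 1" e] by (simp add: indicator_def)
    qed
    then show ?thesis unfolding P_MM_def using fin M
      by (intro CollectI exI[of _ "\<lambda>N. if N = M then 1 else 0"]) auto
  qed
  moreover have "(\<Sum>e\<in>incident E j. x i e) \<le> y i" if "j \<in> V" for i j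
  proof (cases "i \<in> S")
    case True
    have "(\<Sum>e\<in>incident E j. x i e) \<le> (\<Sum>e\<in>incident E j. indicator M e)"
      by (intro sum_mono) (auto simp: x_def)
    also have "\<dots> = 1"
      using perfect_matching_degree[OF finite_sets(3) _ that] M
      by (simp add: maximum_matching_iff_perfect[OF pm])
    finally show ?thesis using True by (simp add: y_def)
  next
    case False
    then show ?thesis using \<sigma> by (auto simp: x_def y_def intro!: sum_nonpos)
  qed
  ultimately have "flm_lp_feasible I (x, y)"
    by (auto simp: flm_lp_feasible_def x_def y_def)
  moreover have "flm_lp_cost I (x, y) = flm_cost I (S, M, \<sigma>)"
  proof -
    have "(\<Sum>i\<in>F. f i * y i) = sum f S"
      using S finite_sets
      by (simp add: y_def sum_mult_indicator Int_absorb1 flip: Int_def)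
    moreover have "(\<Sum>i\<in>F. \<Sum>e\<in>E. dist_edge I i e * x i e) = (\<Sum>e\<in>M. dist_edge I (\<sigma> e) e)"
      using ME finite_sets
      by (subst sum.swap) (simp add: sum_x[of "dist_edge I"] sum.If_cases Int_absorb1)
    ultimately show ?thesis by (simp add: flm_lp_cost_def flm_cost_def)
  qed
  ultimately show ?thesis by blast
qed

section \<open>Matching solutions built from UFL solutions\<close>

lemma nearest_solution:
  assumes s: "ufl_solution (flm_to_ufl I) (S, \<sigma>)" and M: "perfect_matching V E M"
    and le: "(\<Sum>e\<in>M. dist_set_edge I S e) \<le> (\<Sum>v\<in>V. d (\<sigma> v) v) + K"
    and a: "\<And>e. e \<in> M \<Longrightarrow> is_arg_min (\<lambda>i. dist_edge I i e) (\<lambda>i. i \<in> S) (a e)"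
  shows "flm_solution I (S, M, a)" "flm_cost I (S, M, a) \<le> ufl_cost (flm_to_ufl I) (S, \<sigma>) + K"
proof -
  have S: "S \<subseteq> F" using s by (simp add: ufl_solution_def flm_to_ufl_def)
  have aS: "a e \<in> S" if "e \<in> M" for e using a[OF that] by (simp add: is_arg_min_def)
  show "flm_solution I (S, M, a)"
    using S M aS by (auto simp: flm_solution_def maximum_matching_iff_perfect[OF pm])
  have "dist_edge I (a e) e \<le> dist_set_edge I S e" if "e \<in> M" for e
    unfolding dist_set_edge_def
    using a[OF that] aS[OF that] finite_subset[OF S finite_sets(1)]
    by (intro Min.boundedI) (auto simp: is_arg_min_linorder)
  then have "(\<Sum>e\<in>M. dist_edge I (a e) e) \<le> (\<Sum>e\<in>M. dist_set_edge I S e)"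
    by (rule sum_mono)
  then show "flm_cost I (S, M, a) \<le> ufl_cost (flm_to_ufl I) (S, \<sigma>) + K"
    using le by (simp add: flm_cost_def ufl_cost_def flm_to_ufl_def)
qed

text \<open>A nearest open facility exists only for nonempty \<open>S\<close>; an edge to be served
  has clients, and these are assigned into \<open>S\<close>.\<close>

lemma facilities_nonempty:
  assumes "ufl_solution (flm_to_ufl I) (S, \<sigma>)" "perfect_matching V E M" "e \<in> M"
  shows "S \<noteq> {}"
proof -
  have "e \<in> E" using assms(2,3) by (auto simp: perfect_matching_def matching_def)
  then obtain v where "v \<in> V" by (auto elim: edge)
  then show ?thesis using assms(1) by (auto simp: ufl_solution_def flm_to_ufl_def)
qed

lemma flm_cost_nonneg:
  assumes "flm_solution I s"
  shows "0 \<le> flm_cost I s"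
proof -
  obtain S M \<sigma> where s: "s = (S, M, \<sigma>)" by (cases s)
  have "0 \<le> sum f S" using assms f_nonneg by (intro sum_nonneg) (auto simp: s flm_solution_def)
  then show ?thesis by (simp add: s flm_cost_def sum_nonneg dist_edge_nonneg)
qed

lemma flm_lp_cost_parts_nonneg:
  assumes "flm_lp_feasible I (x, y)"
  shows "0 \<le> (\<Sum>i\<in>F. f i * y i)" "0 \<le> (\<Sum>i\<in>F. \<Sum>e\<in>E. dist_edge I i e * x i e)"
  using assms f_nonneg dist_edge_nonneg
  by (auto simp: flm_lp_feasible_def intro!: sum_nonneg mult_nonneg_nonneg)

text \<open>The crude bound, uniform over all solutions, provides the integrability needed for
  expected costs.\<close>

lemma ufl_cost_le:
  assumes "ufl_solution (flm_to_ufl I) s"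
  shows "0 \<le> ufl_cost (flm_to_ufl I) s" "ufl_cost (flm_to_ufl I) s \<le> sum f F + (\<Sum>v\<in>V. \<Sum>i\<in>F. d i v)"
proof -
  obtain S \<sigma> where s: "s = (S, \<sigma>)" by (cases s)
  have S: "S \<subseteq> F" and \<sigma>: "\<And>v. v \<in> V \<Longrightarrow> \<sigma> v \<in> S"
    using assms by (auto simp: s ufl_solution_def flm_to_ufl_def)
  have cost: "ufl_cost (flm_to_ufl I) s = sum f S + (\<Sum>v\<in>V. d (\<sigma> v) v)"
    by (simp add: s ufl_cost_def flm_to_ufl_def)
  have "0 \<le> sum f S" using S f_nonneg by (intro sum_nonneg) auto
  then show "0 \<le> ufl_cost (flm_to_ufl I) s" by (simp add: cost sum_nonneg)
  have "sum f S \<le> sum f F" using S f_nonneg finite_sets by (intro sum_mono2) auto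
  moreover have "d (\<sigma> v) v \<le> (\<Sum>i\<in>F. d i v)" if "v \<in> V" for v
    by (rule member_le_sum) (use \<sigma>[OF that] S finite_sets in auto)
  ultimately show "ufl_cost (flm_to_ufl I) s \<le> sum f F + (\<Sum>v\<in>V. \<Sum>i\<in>F. d i v)"
    unfolding cost by (intro add_mono sum_mono)
qed

section \<open>The integrality ratio of one instance\<close>

text \<open>The extra matching cost raises the connection factor from 1 + 2 * exp (-\<gamma>) to 2 +
  2 * exp (-\<gamma>). The fixed-point equation makes this equal to the facility factor
  \<gamma>.\<close>

lemma flm_cost_le_lp_cost:
  assumes p: "flm_lp_feasible I p" and \<gamma>: "1 < \<gamma>" "\<gamma> = 2 + 2 * exp (- \<gamma>)"
    and cond: "exp (- 1) + 2 * exp (- \<gamma>) \<le> (1 + 2 * exp (- \<gamma>)) * ((\<gamma> - 1) / \<gamma>)"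
  shows "\<exists>s. flm_solution I s \<and> flm_cost I s \<le> \<gamma> * flm_lp_cost I p"
proof -
  obtain x y where xy: "p = (x, y)" by (cases p)
  have feas: "flm_lp_feasible I (x, y)" using p xy by simp
  define C where "C = (\<Sum>i\<in>F. \<Sum>e\<in>E. dist_edge I i e * x i e)"
  obtain S \<sigma> where S: "ufl_solution (flm_to_ufl I) (S, \<sigma>)"
    "ufl_cost (flm_to_ufl I) (S, \<sigma>) \<le> \<gamma> * (\<Sum>i\<in>F. f i * y i) + (1 + 2 * exp (- \<gamma>)) * C"
    using ufl_lp_rounding_exists[OF ufl_instance ufl_lp_feasible[OF feas] \<gamma>(1) cond]
    by (auto simp: flm_to_ufl_def ufl_connection_cost C_def)
  have SF: "S \<subseteq> F" "\<sigma> \<in> V \<rightarrow> S" using S(1) by (auto simp: ufl_solution_def flm_to_ufl_def)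
  obtain M where M: "perfect_matching V E M"
    "(\<Sum>e\<in>M. dist_set_edge I S e) \<le> (\<Sum>v\<in>V. d (\<sigma> v) v) + C"
    using cheap_perfect_matching[OF feas SF] unfolding C_def by blast
  have "\<exists>i. is_arg_min (\<lambda>i. dist_edge I i e) (\<lambda>i. i \<in> S) i" if "e \<in> M" for e
    using ex_is_arg_min_if_finite[OF finite_subset[OF SF(1) finite_sets(1)]
        facilities_nonempty[OF S(1) M(1) that]] .
  then obtain a where a: "\<And>e. e \<in> M \<Longrightarrow> is_arg_min (\<lambda>i. dist_edge I i e) (\<lambda>i. i \<in> S) (a e)"
    by metis
  have "flm_cost I (S, M, a) \<le> \<gamma> * (\<Sum>i\<in>F. f i * y i) + (2 + 2 * exp (- \<gamma>)) * C"
    using nearest_solution(2)[OF S(1) M a] S(2) by (simp add: algebra_simps)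
  also have "\<dots> = \<gamma> * flm_lp_cost I p"
    unfolding \<gamma>(2)[symmetric] by (simp add: xy flm_lp_cost_def C_def distrib_left)
  finally show ?thesis using nearest_solution(1)[OF S(1) M a] by blast
qed

text \<open>Every LP point is rounded, and the infimum is taken afterwards. An infeasible LP gives
  ratio 0, and LP value 0 forces optimum 0, again with ratio 0.\<close>

lemma opt_ratio_le:
  assumes "0 \<le> \<gamma>"
    and round: "\<And>p. flm_lp_feasible I p \<Longrightarrow> \<exists>s. flm_solution I s \<and> flm_cost I s \<le> \<gamma> * flm_lp_cost I p"
  shows "flm_opt I / flm_lp_opt I \<le> ereal \<gamma>"
proof (cases "\<exists>p. flm_lp_feasible I p")
  case False
  then have "{p. flm_lp_feasible I p} = {}" by blast
  then have "flm_lp_opt I = \<infinity>" unfolding flm_lp_opt_def by (simp only: image_empty Inf_empty top_ereal_def)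
  then show ?thesis using assms(1) by simp
next
  case True
  then obtain p where p: "flm_lp_feasible I p" by blast
  have opt0: "0 \<le> flm_opt I"
    unfolding flm_opt_def by (rule INF_greatest) (simp add: flm_cost_nonneg)
  have lp0: "0 \<le> flm_lp_opt I"
    unfolding flm_lp_opt_def
  proof (rule INF_greatest)
    fix q assume "q \<in> {p. flm_lp_feasible I p}"
    then show "0 \<le> ereal (flm_lp_cost I q)"
      using flm_lp_cost_parts_nonneg[of "fst q" "snd q"] by (auto simp: flm_lp_cost_def case_prod_beta)
  qed
  have opt_le: "flm_opt I \<le> ereal (\<gamma> * flm_lp_cost I q)" if "flm_lp_feasible I q" for q
  proof -
    obtain s where "flm_solution I s" "flm_cost I s \<le> \<gamma> * flm_lp_cost I q" using round \<open>flm_lp_feasible I q\<close> by blast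
    then show ?thesis unfolding flm_opt_def by (intro INF_lower2[of s]) auto
  qed
  obtain r where r: "flm_opt I = ereal r"
    using opt0 opt_le[OF p] by (cases "flm_opt I") auto
  have "flm_lp_opt I \<le> ereal (flm_lp_cost I p)"
    unfolding flm_lp_opt_def by (rule INF_lower) (simp add: p)
  then obtain l where l: "flm_lp_opt I = ereal l"
    using lp0 by (cases "flm_lp_opt I") auto
  have rl: "r \<le> \<gamma> * l"
  proof (cases "\<gamma> = 0")
    case True
    then show ?thesis using opt_le[OF p] r by simp
  next
    case False
    then have \<gamma>: "0 < \<gamma>" using assms(1) by simp
    have "ereal (r / \<gamma>) \<le> flm_lp_opt I"
      unfolding flm_lp_opt_def
      by (rule INF_greatest) (use opt_le r \<gamma> in \<open>auto simp: field_simps\<close>)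
    then show ?thesis using l \<gamma> by (simp add: field_simps)
  qed
  have "0 \<le> r" "0 \<le> l" using opt0 lp0 r l by auto
  show ?thesis
  proof (cases "l = 0")
    case True
    then have "r = 0" using rl \<open>0 \<le> r\<close> by simp
    then show ?thesis using r l True assms(1) by simp
  next
    case False
    then show ?thesis using r l rl \<open>0 \<le> l\<close> by (simp add: divide_le_eq)
  qed
qed

section \<open>Expected cost of the algorithm\<close>

text \<open>For every outcome, the minimum matching costs no more than the one from
  \<open>cheap_perfect_matching\<close>, so the final cost exceeds the UFL cost by at most
  \<open>C\<close>. Taking expectations raises \<open>lam_c\<close> by one.\<close>

lemma expected_cost_le:
  assumes feas: "flm_lp_feasible I (x, y)"
    and A: "ufl_lp_rounding_approx lam_f lam_c A"
    and pm_min: "\<And>S. S \<subseteq> F \<Longrightarrow>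
      is_arg_min (\<lambda>M. \<Sum>e\<in>M. dist_set_edge I S e) (perfect_matching V E) (m S)"
    and asg_min: "\<And>S e. S \<subseteq> F \<Longrightarrow> S \<noteq> {} \<Longrightarrow> e \<in> m S \<Longrightarrow>
      is_arg_min (\<lambda>i. dist_edge I i e) (\<lambda>i. i \<in> S) (asg S e)"
  defines "p \<equiv> A (flm_to_ufl I) (\<lambda>i j. \<Sum>e\<in>incident E j. x i e) y"
  defines "h \<equiv> (\<lambda>(S, _). (S, m S, asg S))"
  shows "\<forall>s\<in>set_pmf p. flm_solution I (h s)"
    and "measure_pmf.expectation p (\<lambda>s. flm_cost I (h s))
      \<le> lam_f * (\<Sum>i\<in>F. f i * y i) + (1 + lam_c) * (\<Sum>i\<in>F. \<Sum>e\<in>E. dist_edge I i e * x i e)"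
proof -
  define C where "C = (\<Sum>i\<in>F. \<Sum>e\<in>E. dist_edge I i e * x i e)"
  define c where "c = ufl_cost (flm_to_ufl I)"
  define g where "g s = flm_cost I (h s)" for s
  define b where "b = sum f F + (\<Sum>v\<in>V. \<Sum>i\<in>F. d i v)"
  have sol: "ufl_solution (flm_to_ufl I) s" if "s \<in> set_pmf p" for s
    using A ufl_instance ufl_lp_feasible[OF feas] that by (auto simp: ufl_lp_rounding_approx_def p_def)
  have "measure_pmf.expectation p c \<le> lam_f * (\<Sum>i\<in>ufl_F (flm_to_ufl I). ufl_f (flm_to_ufl I) i * y i)
      + lam_c * (\<Sum>i\<in>ufl_F (flm_to_ufl I). \<Sum>j\<in>ufl_C (flm_to_ufl I).
          ufl_d (flm_to_ufl I) i j * (\<Sum>e\<in>incident E j. x i e))"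
    using A ufl_instance ufl_lp_feasible[OF feas] unfolding ufl_lp_rounding_approx_def p_def c_def by blast
  then have Ec: "measure_pmf.expectation p c \<le> lam_f * (\<Sum>i\<in>F. f i * y i) + lam_c * C"
    by (simp add: flm_to_ufl_def ufl_connection_cost C_def)
  have main: "flm_solution I (h s) \<and> g s \<le> c s + C" if "s \<in> set_pmf p" for s
  proof -
    obtain S \<sigma> where s: "s = (S, \<sigma>)" by (cases s)
    have uS: "ufl_solution (flm_to_ufl I) (S, \<sigma>)" using sol[OF that] s by simp
    then have S: "S \<subseteq> F" "\<sigma> \<in> V \<rightarrow> S" by (auto simp: ufl_solution_def flm_to_ufl_def)
    have mS: "perfect_matching V E (m S)"
      using pm_min[OF S(1)] by (simp add: is_arg_min_def)
    obtain M where M: "perfect_matching V E M"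
      "(\<Sum>e\<in>M. dist_set_edge I S e) \<le> (\<Sum>v\<in>V. d (\<sigma> v) v) + C"
      using cheap_perfect_matching[OF feas S] unfolding C_def by blast
    have "(\<Sum>e\<in>m S. dist_set_edge I S e) \<le> (\<Sum>e\<in>M. dist_set_edge I S e)"
      using pm_min[OF S(1)] M(1) by (simp add: is_arg_min_linorder)
    then have le: "(\<Sum>e\<in>m S. dist_set_edge I S e) \<le> (\<Sum>v\<in>V. d (\<sigma> v) v) + C" using M(2) by simp
    have "is_arg_min (\<lambda>i. dist_edge I i e) (\<lambda>i. i \<in> S) (asg S e)" if "e \<in> m S" for e
      using asg_min[OF S(1) facilities_nonempty[OF uS mS that] that] .
    from nearest_solution[OF uS mS le this] show ?thesis by (simp add: s h_def g_def c_def)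
  qed
  show "\<forall>s\<in>set_pmf p. flm_solution I (h s)" using main by blast
  \<comment> \<open>The distribution may have infinite support, and a Bochner integral is 0 for a
    non-integrable function; boundedness makes the expectations comparable.\<close>
  have int_c: "integrable (measure_pmf p) c"
    by (rule measure_pmf.integrable_const_bound[where B = b])
      (use sol ufl_cost_le in \<open>auto simp: AE_measure_pmf_iff c_def b_def\<close>)
  have int_g: "integrable (measure_pmf p) g"
  proof (rule measure_pmf.integrable_const_bound[where B = "b + C"])
    have "\<bar>g s\<bar> \<le> b + C" if "s \<in> set_pmf p" for s
      using main[OF that] flm_cost_nonneg[of "h s"] ufl_cost_le(2)[OF sol[OF that]]
      by (simp add: g_def c_def b_def)
    then show "AE s in measure_pmf p. norm (g s) \<le> b + C" by (simp add: AE_measure_pmf_iff)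
  qed simp
  have "measure_pmf.expectation p g \<le> measure_pmf.expectation p (\<lambda>s. c s + C)"
    using main int_c int_g by (intro integral_mono_AE) (auto simp: AE_measure_pmf_iff)
  also have "\<dots> = measure_pmf.expectation p c + C"
    using int_c by simp
  finally show "measure_pmf.expectation p (\<lambda>s. flm_cost I (h s))
      \<le> lam_f * (\<Sum>i\<in>F. f i * y i) + (1 + lam_c) * (\<Sum>i\<in>F. \<Sum>e\<in>E. dist_edge I i e * x i e)"
    using Ec unfolding g_def C_def[symmetric] by (simp add: algebra_simps)
qed

end

lemma algorithm_approximation:
  assumes lam: "0 < lam" and A: "ufl_lp_rounding_approx lam (1 + 2 / exp lam) A"
    and lp: "flm_lp_solver lp" and solver: "min_perfect_matching_solver pm"
    and asg: "nearest_facility_assignment pm asg"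
  shows "flm_approximation pm_instances (max lam (2 + 2 / exp lam)) (flm_algorithm A lp pm asg)"
  unfolding flm_approximation_def
proof (intro ballI impI)
  fix I :: "'a flm" assume I: "I \<in> pm_instances" and ex: "\<exists>s. flm_solution I s"
  interpret pm_instance I by unfold_locales (rule I)
  define \<rho> where "\<rho> = max lam (2 + 2 / exp lam)"
  have \<rho>: "0 < \<rho>" "lam \<le> \<rho>" "2 + 2 / exp lam \<le> \<rho>" using lam by (auto simp: \<rho>_def)
  have lp_le: "\<exists>p. flm_lp_feasible I p \<and> flm_lp_cost I p = flm_cost I s" if "flm_solution I s" for s
    using flm_solution_lp_point that by (cases s) auto
  obtain x y where xy: "lp I = (x, y)" by (cases "lp I")
  have arg: "is_arg_min (flm_lp_cost I) (flm_lp_feasible I) (x, y)"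
    using lp I ex lp_le xy unfolding flm_lp_solver_def by metis
  then have feas: "flm_lp_feasible I (x, y)" by (simp add: is_arg_min_def)
  define h where "h = (\<lambda>(S, _ :: 'a \<Rightarrow> 'a). (S, pm I S, asg I S))"
  define p where "p = A (flm_to_ufl I) (\<lambda>i j. \<Sum>e\<in>incident E j. x i e) y"
  have alg: "flm_algorithm A lp pm asg I = map_pmf h p"
    by (simp add: flm_algorithm_def xy h_def p_def)
  have pm_min: "is_arg_min (\<lambda>M. \<Sum>e\<in>M. dist_set_edge I S e) (perfect_matching V E) (pm I S)"
    if "S \<subseteq> F" for S
    using solver I that by (simp add: min_perfect_matching_solver_def)
  have asg_min: "is_arg_min (\<lambda>i. dist_edge I i e) (\<lambda>i. i \<in> S) (asg I S e)"
    if "S \<subseteq> F" "S \<noteq> {}" "e \<in> pm I S" for S e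
    using asg I that by (simp add: nearest_facility_assignment_def)
  have main: "\<forall>s\<in>set_pmf p. flm_solution I (h s)"
    "measure_pmf.expectation p (\<lambda>s. flm_cost I (h s))
      \<le> lam * (\<Sum>i\<in>F. f i * y i) + (1 + (1 + 2 / exp lam)) * (\<Sum>i\<in>F. \<Sum>e\<in>E. dist_edge I i e * x i e)"
    unfolding p_def h_def using expected_cost_le[OF feas A pm_min asg_min] by simp_all
  define ex where "ex = measure_pmf.expectation p (\<lambda>s. flm_cost I (h s))"
  have "ex \<le> \<rho> * (\<Sum>i\<in>F. f i * y i) + \<rho> * (\<Sum>i\<in>F. \<Sum>e\<in>E. dist_edge I i e * x i e)"
    unfolding ex_def
    by (rule order_trans[OF main(2)], intro add_mono mult_right_mono)
      (use \<rho> flm_lp_cost_parts_nonneg[OF feas] in auto)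
  also have "\<dots> = \<rho> * flm_lp_cost I (x, y)"
    by (simp add: flm_lp_cost_def distrib_left)
  \<comment> \<open>Dividing by \<rho> turns the claim into a lower bound on the infimum
    \<open>flm_opt I\<close>; the factor is restored afterwards in \<open>ereal\<close>.\<close>
  finally have ex_le: "ex / \<rho> \<le> flm_lp_cost I (x, y)" using \<rho>(1) by (simp add: field_simps)
  have "ereal (ex / \<rho>) \<le> flm_opt I"
    unfolding flm_opt_def
  proof (rule INF_greatest)
    fix s assume "s \<in> {s. flm_solution I s}"
    then obtain q where q: "flm_lp_feasible I q" "flm_lp_cost I q = flm_cost I s" using lp_le by blast
    have "flm_lp_cost I (x, y) \<le> flm_lp_cost I q" using arg q(1) unfolding is_arg_min_linorder by blast
    then show "ereal (ex / \<rho>) \<le> ereal (flm_cost I s)" using ex_le q(2) by simp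
  qed
  then have "ereal \<rho> * ereal (ex / \<rho>) \<le> ereal \<rho> * flm_opt I"
    using \<rho>(1) by (intro ereal_mult_left_mono) auto
  then have "ereal ex \<le> ereal \<rho> * flm_opt I" using \<rho>(1) by simp
  then show "(\<forall>s\<in>set_pmf (flm_algorithm A lp pm asg I). flm_solution I s)
      \<and> ereal (measure_pmf.expectation (flm_algorithm A lp pm asg I) (flm_cost I))
        \<le> ereal (max lam (2 + 2 / exp lam)) * flm_opt I"
    using main(1) by (simp add: alg ex_def \<rho>_def)
qed

section \<open>The balanced parameter and the integrality gap\<close>

text \<open>The intermediate value theorem on [2, e]: the difference of the two sides is negative at
  2, and at e it is at least 1/2 - 2 * (1/4) = 0.\<close>

lemma balanced_parameter_exists:
  "\<exists>\<gamma>::real. 2 \<le> \<gamma> \<and> \<gamma> \<le> exp 1 \<and> \<gamma> = 2 + 2 * exp (- \<gamma>)"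
proof -
  have e: "5 / 2 \<le> exp (1::real)" using exp_lower_Taylor_quadratic[of "1::real"] by simp
  have "4 \<le> exp (2::real)" using exp_lower_Taylor_quadratic[of "2::real"] by simp
  also have "exp (2::real) \<le> exp (exp 1)" using e by simp
  finally have "exp (- exp 1 :: real) \<le> 1 / 4" by (simp add: exp_minus field_simps)
  then have "\<exists>\<gamma>\<ge>2. \<gamma> \<le> exp 1 \<and> \<gamma> - 2 - 2 * exp (- \<gamma>) = (0::real)"
    using e by (intro IVT') (auto intro!: continuous_intros)
  then show ?thesis by force
qed

lemma integrality_gap_le:
  fixes lam :: real
  shows "flm_integrality_gap (pm_instances :: 'a flm set) \<le> ereal (max lam (2 + 2 / exp lam))"
proof -
  obtain \<gamma> :: real where \<gamma>: "2 \<le> \<gamma>" "\<gamma> \<le> exp 1" "\<gamma> = 2 + 2 * exp (- \<gamma>)"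
    using balanced_parameter_exists by blast
  \<comment> \<open>Substituting 2 * exp (-\<gamma>) = \<gamma> - 2 turns the condition of
    \<open>client_bound\<close> into 1/e \<le> 1/\<gamma>, which is where \<gamma> \<le> e
    enters.\<close>
  have "exp (- 1) \<le> 1 / \<gamma>" using \<gamma>(1,2) by (simp add: exp_minus field_simps)
  then have "exp (- 1) + (\<gamma> - 2) \<le> 1 / \<gamma> + (\<gamma> - 2)" by simp
  also have "\<dots> = (\<gamma> - 1) * ((\<gamma> - 1) / \<gamma>)" using \<gamma>(1) by (simp add: field_simps)
  finally have cond: "exp (- 1) + 2 * exp (- \<gamma>) \<le> (1 + 2 * exp (- \<gamma>)) * ((\<gamma> - 1) / \<gamma>)"
    using \<gamma>(3) by (smt (verit))
  have "flm_opt I / flm_lp_opt I \<le> ereal \<gamma>" if "I \<in> pm_instances" for I :: "'a flm"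
  proof -
    interpret pm_instance I by unfold_locales (rule that)
    show ?thesis
      by (rule opt_ratio_le) (use \<gamma>(1) flm_cost_le_lp_cost[OF _ _ \<gamma>(3) cond] in auto)
  qed
  then have "flm_integrality_gap (pm_instances :: 'a flm set) \<le> ereal \<gamma>"
    unfolding flm_integrality_gap_def by (rule SUP_least)
  \<comment> \<open>One term of the maximum increases in \<open>lam\<close>, the other decreases,
    and they meet at \<gamma>; hence the bound at \<gamma> implies it for every
    \<open>lam\<close>.\<close>
  also have "\<gamma> \<le> max lam (2 + 2 / exp lam)"
  proof (cases "lam \<le> \<gamma>")
    case True
    then have "exp (- \<gamma>) \<le> exp (- lam)" by simp
    moreover have "2 / exp lam = 2 * exp (- lam)" by (simp add: exp_minus divide_inverse)
    ultimately have "\<gamma> \<le> 2 + 2 / exp lam" using \<gamma>(3) by linarith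
    then show ?thesis by simp
  qed simp
  finally show ?thesis by simp
qed

theorem theorem4:
  shows "(\<forall>(lam::real) (A :: ('a, 'a) ufl_rounding) lp pm asg.
            lam \<ge> 1.678 \<and> ufl_lp_rounding_approx lam (1 + 2 / exp lam) A
            \<and> flm_lp_solver lp \<and> min_perfect_matching_solver pm
            \<and> nearest_facility_assignment pm asg
            \<longrightarrow> flm_approximation pm_instances (max lam (2 + 2 / exp lam))
                  (flm_algorithm A lp pm asg))
       \<and> (\<forall>lam::real. lam \<ge> 1.678 \<longrightarrow>
            flm_integrality_gap (pm_instances :: 'a flm set)
              \<le> ereal (max lam (2 + 2 / exp lam)))"
proof (intro conjI allI impI)
  fix lam :: real and A :: "('a, 'a) ufl_rounding"
    and lp :: "'a flm \<Rightarrow> 'a flm_lp_point" and pm :: "'a flm \<Rightarrow> 'a set \<Rightarrow> 'a set set" and asg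
  assume "lam \<ge> 1.678 \<and> ufl_lp_rounding_approx lam (1 + 2 / exp lam) A
    \<and> flm_lp_solver lp \<and> min_perfect_matching_solver pm \<and> nearest_facility_assignment pm asg"
  moreover from this have "0 < lam" by simp
  ultimately show "flm_approximation pm_instances (max lam (2 + 2 / exp lam))
      (flm_algorithm A lp pm asg)"
    by (intro algorithm_approximation) simp_all
qed (rule integrality_gap_le)

end
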